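(* Let $n\ge 1$ and $p\in\{0,1,2,\dots\}\cup\{+\infty\}$. Let $\Omega_1,\dots,\Omega_n\subseteq\mathbb{C}$ be Jordan domains, let $\phi_i:\overline{D}\to\overline{\Omega_i}$ be the homeomorphic extensions of Riemann mappings $D\to\Omega_i$, let $\gamma_i=\phi_i|_{\mathbb{T}}$ and $\gamma=\gamma_1\times\cdots\times\gamma_n:\mathbb{T}^n\to\partial\Omega_1\times\cdots\times\partial\Omega_n$. If all $\gamma_i$ are analytic curves, then for every fixed point of $\gamma(\mathbb{T}^n)$, the set of functions in $C^p(\gamma)$ that are not real analytic at that point is a dense $G_\delta$ subset of $C^p(\gamma)$; likewise, the set of functions in $C^p(\gamma)$ that are real analytic at no point of $\gamma(\mathbb{T}^n)$ is a dense $G_\delta$ subset of $C^p(\gamma)$.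
   Context: $D$ is the open unit disc and $\mathbb{T}$ the unit circle in $\mathbb{C}$. By the Carathéodory–Osgood theorem a Riemann mapping $D\to\Omega_i$ onto a Jordan domain extends to a homeomorphism $\overline{D}\to\overline{\Omega_i}$. The curve $\gamma_i$ is an analytic curve if it extends to a biholomorphism between an open neighborhood of $\mathbb{T}$ and an open neighborhood of $\partial\Omega_i$. $C^p(\mathbb{T}^n)$ is the space of functions $g:\mathbb{T}^n\to\mathbb{C}$ whose derivatives $\frac{\partial^{\alpha}g}{\partial\theta^{\alpha}}(e^{i\theta_1},\dots,e^{i\theta_n})$ with respect to $\theta_1,\dots,\theta_n$ exist and are continuous on $\mathbb{T}^n$ for all multi-indices $|\alpha|\le p$ (all $\alpha$ if $p=+\infty$). $C^p(\gamma)$ is the space of functions $f:\gamma(\mathbb{T}^n)\to\mathbb{C}$ such that $f\circ\gamma\in C^p(\mathbb{T}^n)$, with the topology given by the seminorms $|f|_\alpha=\sup_{\theta_i\in\mathbb{R}}\left|\frac{\partial^{\alpha}(f\circ\gamma)}{\partial\theta^{\alpha}}(e^{i\theta_1},\dots,e^{i\theta_n})\right|$, $|\alpha|\le p$. A function $g:\mathbb{T}^n\to\mathbb{C}$ is real analytic at $(e^{i\theta_1},\dots,e^{i\theta_n})$ if there are $\delta>0$ and a power series in $(t_1-\theta_1),\dots,(t_n-\theta_n)$ with complex coefficients converging absolutely and uniformly on $\prod_{i=1}^n[\theta_i-\delta,\theta_i+\delta]$ to $g(e^{it_1},\dots,e^{it_n})$. A function $f:\gamma(\mathbb{T}^n)\to\mathbb{C}$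 is real analytic at $\gamma(t)$, $t\in\mathbb{T}^n$, if $f\circ\gamma$ is real analytic at $t$. *)

theory Defs
  imports "HOL-Complex_Analysis.Complex_Analysis" "HOL-Library.Extended_Nat"
begin

section \<open>Jordan domains, Riemann mappings and analytic curves\<close>

definition Jordan_domain :: "complex set \<Rightarrow> bool" where
  "Jordan_domain \<Omega> \<longleftrightarrow>
     (\<exists>c. simple_path c \<and> pathfinish c = pathstart c \<and> \<Omega> = inside (path_image c))"

definition biholomorphism :: "complex set \<Rightarrow> complex set \<Rightarrow> (complex \<Rightarrow> complex) \<Rightarrow> bool" where
  "biholomorphism U V f \<longleftrightarrow>
     f holomorphic_on U \<and> bij_betw f U V \<and> inv_into U f holomorphic_on V"

definition extended_Riemann_map :: "complex set \<Rightarrow> (complex \<Rightarrow> complex) \<Rightarrow> bool" where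
  "extended_Riemann_map \<Omega> \<phi> \<longleftrightarrow>
     biholomorphism (ball 0 1) \<Omega> \<phi> \<and>
     (\<exists>\<psi>. homeomorphism (cball 0 1) (closure \<Omega>) \<phi> \<psi>)"

definition analytic_boundary_curve :: "complex set \<Rightarrow> (complex \<Rightarrow> complex) \<Rightarrow> bool" where
  "analytic_boundary_curve \<Omega> c \<longleftrightarrow>
     (\<exists>U V \<Phi>. open U \<and> sphere 0 1 \<subseteq> U \<and> open V \<and> frontier \<Omega> \<subseteq> V \<and>
        biholomorphism U V \<Phi> \<and> (\<forall>z\<in>sphere 0 1. \<Phi> z = c z))"


section \<open>The torus\<close>

type_synonym 'n rvec = "(real, 'n) vec"
type_synonym 'n cvec = "(complex, 'n) vec"

definition torus :: "'n::finite cvec set" where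
  "torus = {z. \<forall>i. z $ i \<in> sphere 0 1}"

definition cis_vec :: "'n::finite rvec \<Rightarrow> 'n cvec" where
  "cis_vec \<theta> = (\<chi> i. cis (\<theta> $ i))"

definition prod_curve :: "('n::finite \<Rightarrow> complex \<Rightarrow> complex) \<Rightarrow> 'n cvec \<Rightarrow> 'n cvec" where
  "prod_curve c z = (\<chi> i. c i (z $ i))"


section \<open>Derivatives with respect to the angles\<close>

definition partial_deriv :: "'n::finite \<Rightarrow> ('n rvec \<Rightarrow> complex) \<Rightarrow> 'n rvec \<Rightarrow> complex" where
  "partial_deriv j F \<theta> = vector_derivative (\<lambda>s. F (\<theta> + s *\<^sub>R axis j 1)) (at 0)"

definition partial_differentiable :: "'n::finite \<Rightarrow> ('n rvec \<Rightarrow> complex) \<Rightarrow> bool" where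
  "partial_differentiable j F \<longleftrightarrow>
     (\<forall>\<theta>. (\<lambda>s. F (\<theta> + s *\<^sub>R axis j 1)) differentiable (at 0))"

definition mi_order :: "('n::finite \<Rightarrow> nat) \<Rightarrow> enat" where
  "mi_order \<alpha> = enat (\<Sum>i\<in>UNIV. \<alpha> i)"

text \<open>
  The order on the index type fixes the order of differentiation: if the indices are
  \<open>1 < \<dots> < n\<close>, then \<open>multi_deriv \<alpha> F\<close> is
  \<open>\<partial>\<^sub>1\<close> applied \<open>\<alpha> 1\<close> times to \<open>\<dots>\<close> to \<open>\<partial>\<^sub>n\<close> applied \<open>\<alpha> n\<close> times to \<open>F\<close>.
\<close>
definition multi_deriv ::
    "('n::{finite,linorder} \<Rightarrow> nat) \<Rightarrow> ('n rvec \<Rightarrow> complex) \<Rightarrow> 'n rvec \<Rightarrow> complex" where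
  "multi_deriv \<alpha> F = foldr (\<lambda>j. partial_deriv j ^^ \<alpha> j) (sorted_list_of_set UNIV) F"

text \<open>
  The predicate below depends only on the values of \<open>g\<close> on the torus. When \<open>\<alpha>\<close> vanishes
  below \<open>j\<close>, the operator for \<open>\<alpha>\<close> with entry \<open>j\<close> increased by one is \<open>\<partial>\<^sub>j\<close> after the one for
  \<open>\<alpha>\<close>; every multi-index of positive order arises in this way, so the first conjunct says
  that all derivatives of order at most \<open>p\<close> exist. (By Schwarz's theorem, together with the
  continuity requirement this does not depend on the order of differentiation.) The
  derivatives are periodic in each angle, so their continuity as functions of the angles is
  their continuity on the torus.
\<close>
definition Cp_torus :: "enat \<Rightarrow> ('n::{finite,linorder} cvec \<Rightarrow> complex) \<Rightarrow> bool" where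
  "Cp_torus p g \<longleftrightarrow>
     (\<forall>\<alpha> j. mi_order \<alpha> < p \<and> (\<forall>i<j. \<alpha> i = 0) \<longrightarrow>
        partial_differentiable j (multi_deriv \<alpha> (\<lambda>\<theta>. g (cis_vec \<theta>)))) \<and>
     (\<forall>\<alpha>. mi_order \<alpha> \<le> p \<longrightarrow> continuous_on UNIV (multi_deriv \<alpha> (\<lambda>\<theta>. g (cis_vec \<theta>))))"


section \<open>The space of functions on the image of the torus\<close>

definition Cp_space ::
    "('n::{finite,linorder} cvec \<Rightarrow> 'n cvec) \<Rightarrow> enat \<Rightarrow> ('n cvec \<Rightarrow> complex) set" where
  "Cp_space \<gamma> p = {f \<in> extensional (\<gamma> ` torus). Cp_torus p (f \<circ> \<gamma>)}"

definition Cp_seminorm ::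
    "('n::{finite,linorder} cvec \<Rightarrow> 'n cvec) \<Rightarrow> ('n \<Rightarrow> nat) \<Rightarrow> ('n cvec \<Rightarrow> complex) \<Rightarrow> real" where
  "Cp_seminorm \<gamma> \<alpha> f = (SUP \<theta>. cmod (multi_deriv \<alpha> (\<lambda>\<theta>. (f \<circ> \<gamma>) (cis_vec \<theta>)) \<theta>))"

definition Cp_topology ::
    "('n::{finite,linorder} cvec \<Rightarrow> 'n cvec) \<Rightarrow> enat \<Rightarrow> ('n cvec \<Rightarrow> complex) topology" where
  "Cp_topology \<gamma> p = topology_generated_by
     {{g \<in> Cp_space \<gamma> p. Cp_seminorm \<gamma> \<alpha> (\<lambda>w. g w - f w) < \<epsilon>} | f \<alpha> \<epsilon>.
        f \<in> Cp_space \<gamma> p \<and> mi_order \<alpha> \<le> p \<and> \<epsilon> > 0}"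

lemma multi_deriv_zero: "multi_deriv \<alpha> (\<lambda>_. 0) = (\<lambda>_. 0)"
proof -
  have *: "(partial_deriv j ^^ k) (\<lambda>_. 0) = (\<lambda>_. 0)" for j :: 'a and k
    by (induction k) (simp_all add: partial_deriv_def fun_eq_iff)
  have "foldr (\<lambda>j. partial_deriv j ^^ \<alpha> j) js (\<lambda>_. 0) = (\<lambda>_. 0)" for js
    by (induction js) (simp_all add: *)
  then show ?thesis
    by (simp add: multi_deriv_def)
qed

lemma topspace_Cp_topology: "topspace (Cp_topology \<gamma> p) = Cp_space \<gamma> p"
proof
  show "Cp_space \<gamma> p \<subseteq> topspace (Cp_topology \<gamma> p)"
  proof
    fix f assume f: "f \<in> Cp_space \<gamma> p"
    let ?B = "{g \<in> Cp_space \<gamma> p. Cp_seminorm \<gamma> (\<lambda>_. 0) (\<lambda>w. g w - f w) < 1}"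
    have "mi_order (\<lambda>_::'a. 0) \<le> p"
      by (simp add: mi_order_def zero_enat_def[symmetric])
    then have "?B \<in> {{g \<in> Cp_space \<gamma> p. Cp_seminorm \<gamma> \<alpha> (\<lambda>w. g w - f w) < \<epsilon>} | f \<alpha> \<epsilon>.
        f \<in> Cp_space \<gamma> p \<and> mi_order \<alpha> \<le> p \<and> \<epsilon> > 0}"
      using f by (intro CollectI exI[of _ f] exI[of _ "\<lambda>_. 0"] exI[of _ "1::real"]) simp
    moreover have "f \<in> ?B"
      using f by (simp add: Cp_seminorm_def multi_deriv_zero o_def)
    ultimately show "f \<in> topspace (Cp_topology \<gamma> p)"
      unfolding Cp_topology_def topology_generated_by_topspace by (rule UnionI)
  qed
  show "topspace (Cp_topology \<gamma> p) \<subseteq> Cp_space \<gamma> p"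
    unfolding Cp_topology_def topology_generated_by_topspace by blast
qed

definition dense_gdelta_in :: "'a topology \<Rightarrow> 'a set \<Rightarrow> bool" where
  "dense_gdelta_in X S \<longleftrightarrow> gdelta_in X S \<and> X closure_of S = topspace X"


section \<open>Real analyticity\<close>

text \<open>
  Multi-indices are not ordered, so the power series is summed along the net of finite sets
  of multi-indices; under absolute convergence the order of summation is immaterial. The
  choice of the angles \<open>\<theta>\<close> representing the point \<open>t\<close> is immaterial by periodicity.
\<close>
definition torus_real_analytic_at :: "('n::finite cvec \<Rightarrow> complex) \<Rightarrow> 'n cvec \<Rightarrow> bool" where
  "torus_real_analytic_at g t \<longleftrightarrow>
     (\<exists>\<theta>. t = cis_vec \<theta> \<and>
       (\<exists>\<delta>>0. \<exists>a :: ('n \<Rightarrow> nat) \<Rightarrow> complex.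
         let B = {x. \<forall>i. x $ i \<in> {\<theta> $ i - \<delta> .. \<theta> $ i + \<delta>}};
             u = (\<lambda>\<alpha> x. a \<alpha> * (\<Prod>i\<in>UNIV. of_real (x $ i - \<theta> $ i) ^ \<alpha> i))
         in (\<forall>x\<in>B. (\<lambda>\<alpha>. norm (u \<alpha> x)) summable_on UNIV) \<and>
            uniform_limit B (\<lambda>A x. \<Sum>\<alpha>\<in>A. u \<alpha> x) (\<lambda>x. g (cis_vec x))
              (finite_subsets_at_top UNIV)))"

definition curve_real_analytic_at ::
    "('n::finite cvec \<Rightarrow> 'n cvec) \<Rightarrow> ('n cvec \<Rightarrow> complex) \<Rightarrow> 'n cvec \<Rightarrow> bool" where
  "curve_real_analytic_at \<gamma> f w \<longleftrightarrow> (\<exists>t\<in>torus. w = \<gamma> t \<and> torus_real_analytic_at (f \<circ> \<gamma>) t)"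

end

theory Submission
  imports Defs "HOL-Real_Asymp.Real_Asymp"
begin

text \<open>
  Composing a function on the image of the torus with \<open>\<gamma>\<close> and with the angles turns it into
  a periodic function on \<open>\<real>\<^sup>n\<close>. As \<open>\<gamma>\<close> is a product of restrictions of homeomorphisms, it is
  injective, so that every periodic function arises in this way, and real analyticity at
  \<open>\<gamma>(e^(i \<theta>))\<close> is real analyticity of the composition at \<open>\<theta>\<close>.

  The analytic functions form an F-sigma set by compactness. A function is real analytic at
  \<open>\<theta>\<close> if and only if, for some \<open>k \<ge> 1\<close>, it is represented near \<open>\<theta>\<close>, on a cube
  whose size depends on \<open>k\<close>, by a power series whose coefficients satisfy
  \<open>|a\<^sub>\<alpha>| \<le> k^(|\<alpha>|+1)\<close> (\<open>torus_real_analytic_at_iff\<close>). For fixed \<open>k\<close> these coefficient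
  families form a compact product of discs, on which the values of the series depend
  continuously. Hence the functions that have such an expansion about some point of a given
  compact set of angles form the projection of a closed set along a compact factor, and this
  is closed (\<open>closedin_has_power_series\<close>). The union over \<open>k\<close>, for a single point or for a
  full period cube, is the complement of the set in question.

  For density it suffices to treat the functions that are nowhere real analytic. The series
  \<open>\<Sum>\<^sub>k 2^(-k\<^sup>2) e^(i 2^k x)\<close> is smooth, and its derivatives at dyadic
  multiples of \<open>2\<pi>\<close> are so large that it has no holomorphic extension
  near any real point (\<open>lacunary_no_holomorphic_extension\<close>). Let \<open>g\<close> be this series in one of
  the angles. A function that is analytic at one point extends holomorphically along that
  coordinate at all points of an open set, hence at a point of a fixed countable dense set. No
  such point can serve two functions \<open>f + \<epsilon> g\<close> with different \<open>\<epsilon>\<close>, for otherwise it would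
  serve \<open>g\<close>. So for all but countably many \<open>\<epsilon>\<close> the function \<open>f + \<epsilon> g\<close> is nowhere real
  analytic (\<open>dense_no_power_series\<close>).
\<close>

section \<open>Power series with geometrically bounded coefficients\<close>

definition total_degree :: "('n::finite \<Rightarrow> nat) \<Rightarrow> nat" where
  "total_degree \<alpha> = (\<Sum>i\<in>UNIV. \<alpha> i)"

definition monomial :: "('n::finite \<Rightarrow> nat) \<Rightarrow> ('n \<Rightarrow> complex) \<Rightarrow> complex" where
  "monomial \<alpha> z = (\<Prod>i\<in>UNIV. z i ^ \<alpha> i)"

definition power_series :: "(('n::finite \<Rightarrow> nat) \<Rightarrow> complex) \<Rightarrow> ('n \<Rightarrow> complex) \<Rightarrow> complex" where
  "power_series a z = (\<Sum>\<^sub>\<infinity>\<alpha>. a \<alpha> * monomial \<alpha> z)"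

text \<open>
  Written as a product of closed discs, so that Tychonoff's theorem makes it compact.
\<close>
definition coeff_box :: "nat \<Rightarrow> (('n::finite \<Rightarrow> nat) \<Rightarrow> complex) set" where
  "coeff_box k = (\<Pi>\<^sub>E \<alpha>\<in>UNIV. cball 0 (real k ^ Suc (total_degree \<alpha>)))"

text \<open>
  The constant \<open>k\<close> bounds the coefficients and also fixes the radius. Each radius of
  convergence and each bound on the coefficients is covered by some \<open>k\<close>, so that countably
  many values of \<open>k\<close> exhaust real analyticity. The radius is half the one suggested by the
  growth of the coefficients, which makes the terms decay like \<open>2^(-|\<alpha>|)\<close>.
\<close>
definition has_power_series :: "nat \<Rightarrow> ('n::finite rvec \<Rightarrow> complex) \<Rightarrow> 'n rvec \<Rightarrow> bool" where
  "has_power_series k F \<theta> \<longleftrightarrow>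
     (\<exists>a\<in>coeff_box k. \<forall>h. (\<forall>i. \<bar>h $ i\<bar> \<le> 1 / (2 * real k)) \<longrightarrow>
        F (\<theta> + h) = power_series a (\<lambda>i. of_real (h $ i)))"

lemma coeff_boxD: "a \<in> coeff_box k \<Longrightarrow> norm (a \<alpha>) \<le> real k ^ Suc (total_degree \<alpha>)"
  by (auto simp: coeff_box_def PiE_iff)

lemma geometric_summable:
  fixes c :: real
  assumes "0 \<le> c" "c < 1"
  shows "(\<lambda>\<alpha>::'n::finite \<Rightarrow> nat. c ^ total_degree \<alpha>) summable_on UNIV"
proof -
  have "(\<lambda>n::nat. norm (c ^ n)) summable_on UNIV"
    using assms by (subst summable_on_UNIV_nonneg_real_iff) (auto simp: norm_power intro: summable_geometric)
  then have "Infinite_Set_Sum.abs_summable_on (\<lambda>\<alpha>::'n \<Rightarrow> nat. \<Prod>i\<in>UNIV. c ^ \<alpha> i) (PiE UNIV (\<lambda>_. UNIV))"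
    by (intro Infinite_Set_Sum.abs_summable_on_prod_PiE) (auto simp: abs_summable_equivalent simp del: real_norm_def)
  then have "(\<lambda>\<alpha>::'n \<Rightarrow> nat. norm (c ^ total_degree \<alpha>)) summable_on UNIV"
    unfolding total_degree_def power_sum PiE_UNIV_domain by (simp flip: abs_summable_equivalent)
  then show ?thesis
    using assms by simp
qed

lemma norm_term_le:
  assumes a: "a \<in> coeff_box k" and k: "k > 0" and z: "\<And>i. norm (z i) \<le> 1 / (2 * real k)"
  shows "norm (a \<alpha> * monomial \<alpha> z) \<le> real k * (1 / 2) ^ total_degree \<alpha>"
proof -
  have "norm (monomial \<alpha> z) = (\<Prod>i\<in>UNIV. norm (z i) ^ \<alpha> i)"
    by (simp add: monomial_def norm_power flip: prod_norm)
  also have "\<dots> \<le> (\<Prod>i\<in>UNIV. (1 / (2 * real k)) ^ \<alpha> i)"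
    by (intro prod_mono conjI power_mono z) auto
  finally have m: "norm (monomial \<alpha> z) \<le> (1 / (2 * real k)) ^ total_degree \<alpha>"
    by (simp add: total_degree_def power_sum)
  have "norm (a \<alpha> * monomial \<alpha> z) \<le> real k ^ Suc (total_degree \<alpha>) * (1 / (2 * real k)) ^ total_degree \<alpha>"
    unfolding norm_mult by (intro mult_mono coeff_boxD[OF a] m) auto
  also have "\<dots> = real k * (1 / 2) ^ total_degree \<alpha>"
    using k by (simp add: power_divide power_mult_distrib)
  finally show ?thesis .
qed

text \<open>
  The coefficients and the point may both depend on the parameter \<open>y\<close>. This one statement
  thereby yields uniform convergence on a cube, holomorphy in one variable, and continuity
  in the coefficients for the product topology.
\<close>
lemma uniform_limit_power_series:
  assumes "k > 0" "\<And>y. y \<in> Y \<Longrightarrow> A y \<in> coeff_box k"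
    and "\<And>y i. y \<in> Y \<Longrightarrow> norm (Z y i) \<le> 1 / (2 * real k)"
  shows "uniform_limit Y (\<lambda>X y. \<Sum>\<alpha>\<in>X. A y \<alpha> * monomial \<alpha> (Z y))
           (\<lambda>y. power_series (A y) (Z y)) (finite_subsets_at_top UNIV)"
  unfolding power_series_def
  by (rule Weierstrass_m_test_general[where M = "\<lambda>\<alpha>. real k * (1 / 2) ^ total_degree \<alpha>"])
     (use assms in \<open>auto intro!: norm_term_le summable_on_cmult_right geometric_summable\<close>)

lemma compact_coeff_box: "compact (coeff_box k)"
proof -
  have "compactin (product_topology (\<lambda>_. euclidean) UNIV)
          (\<Pi>\<^sub>E \<alpha>\<in>UNIV. cball (0::complex) (real k ^ Suc (total_degree \<alpha>)))"
    by (subst compactin_PiE) auto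
  then show ?thesis
    by (simp add: coeff_box_def euclidean_product_topology)
qed

lemma continuous_on_power_series_coeffs:
  assumes "k > 0" "\<And>i. norm (z i) \<le> 1 / (2 * real k)"
  shows "continuous_on (coeff_box k) (\<lambda>a. power_series a z)"
proof (rule uniform_limit_theorem[OF _ uniform_limit_power_series])
  show "\<forall>\<^sub>F X in finite_subsets_at_top UNIV.
      continuous_on (coeff_box k) (\<lambda>a. \<Sum>\<alpha>\<in>X. a \<alpha> * monomial \<alpha> z)"
    by (intro always_eventually allI continuous_intros
         continuous_on_subset[OF continuous_on_product_coordinates]) auto
qed (use assms in auto)

lemma cis_vec_add_cong: "cis_vec \<theta> = cis_vec \<theta>' \<Longrightarrow> cis_vec (\<theta> + h) = cis_vec (\<theta>' + h)"
  by (simp add: cis_vec_def vec_eq_iff flip: cis_mult)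

text \<open>
  Absolute convergence at the corner \<open>\<theta> + (\<delta>, \<dots>, \<delta>)\<close> of the cube bounds
  \<open>|a\<^sub>\<alpha>| \<delta>^|\<alpha>|\<close> independently of \<open>\<alpha>\<close>, which gives the bound on the coefficients. Conversely,
  the decay of the terms gives absolute and uniform convergence on the smaller cube.
\<close>
lemma torus_real_analytic_at_iff:
  fixes \<theta> :: "'a::finite rvec"
  shows
  "torus_real_analytic_at g (cis_vec \<theta>) \<longleftrightarrow> (\<exists>k>0. has_power_series k (\<lambda>x. g (cis_vec x)) \<theta>)"
proof
  assume "torus_real_analytic_at g (cis_vec \<theta>)"
  then obtain \<theta>' \<delta> a where \<theta>': "cis_vec \<theta> = cis_vec \<theta>'" and \<delta>: "\<delta> > 0"
    and summ: "\<And>x. (\<And>i. x $ i \<in> {\<theta>' $ i - \<delta> .. \<theta>' $ i + \<delta>}) \<Longrightarrow>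
        (\<lambda>\<alpha>. norm (a \<alpha> * monomial \<alpha> (\<lambda>i. of_real (x $ i - \<theta>' $ i)))) summable_on UNIV"
    and ul: "uniform_limit {x. \<forall>i. x $ i \<in> {\<theta>' $ i - \<delta> .. \<theta>' $ i + \<delta>}}
        (\<lambda>A x. \<Sum>\<alpha>\<in>A. a \<alpha> * monomial \<alpha> (\<lambda>i. of_real (x $ i - \<theta>' $ i)))
        (\<lambda>x. g (cis_vec x)) (finite_subsets_at_top UNIV)"
    unfolding torus_real_analytic_at_def Let_def monomial_def by blast
  define M where "M = (\<Sum>\<^sub>\<infinity>\<alpha>. norm (a \<alpha> * monomial \<alpha> (\<lambda>i. of_real \<delta>)))"
  have M: "norm (a \<alpha>) * \<delta> ^ total_degree \<alpha> \<le> M" for \<alpha>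
  proof -
    have "(\<lambda>\<alpha>. norm (a \<alpha> * monomial \<alpha> (\<lambda>i. of_real \<delta>))) summable_on UNIV"
      using summ[of "\<chi> i. \<theta>' $ i + \<delta>"] \<delta> by simp
    then have "(\<Sum>\<alpha>\<in>{\<alpha>}. norm (a \<alpha> * monomial \<alpha> (\<lambda>i. of_real \<delta>))) \<le> M"
      unfolding M_def by (intro finite_sum_le_infsum) auto
    then show ?thesis
      using \<delta> by (simp add: monomial_def norm_mult total_degree_def norm_power flip: power_sum)
  qed
  \<comment> \<open>The bound on the coefficients needs both; the second also makes the new cube small enough.\<close>
  obtain k where k: "real k > max M (1 / \<delta>)"
    using reals_Archimedean2 by blast
  have k0: "k > 0"
  proof -
    have "0 < 1 / \<delta>" "1 / \<delta> < real k" using k \<delta> by auto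
    then have "0 < real k" by linarith
    then show ?thesis by simp
  qed
  have k\<delta>: "1 / (2 * real k) \<le> \<delta>"
  proof -
    have "1 \<le> \<delta> * real k" using k \<delta> by (simp add: field_simps)
    then show ?thesis using k0 by (simp add: field_simps)
  qed
  have "a \<in> coeff_box k"
  proof -
    have "norm (a \<alpha>) \<le> real k ^ Suc (total_degree \<alpha>)" for \<alpha>
    proof -
      have "norm (a \<alpha>) = norm (a \<alpha>) * \<delta> ^ total_degree \<alpha> * (1 / \<delta>) ^ total_degree \<alpha>"
        using \<delta> by (simp add: power_divide)
      also have "\<dots> \<le> real k * real k ^ total_degree \<alpha>"
        by (intro mult_mono power_mono order_trans[OF M]) (use k \<delta> in auto)
      finally show ?thesis by simp
    qed
    then show ?thesis by (auto simp: coeff_box_def)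
  qed
  moreover have "g (cis_vec (\<theta> + h)) = power_series a (\<lambda>i. of_real (h $ i))"
    if h: "\<forall>i. \<bar>h $ i\<bar> \<le> 1 / (2 * real k)" for h :: "'a rvec"
  proof -
    have h\<delta>: "\<bar>h $ i\<bar> \<le> \<delta>" for i
      using h k\<delta> order_trans by blast
    have "\<theta>' + h \<in> {x. \<forall>i. x $ i \<in> {\<theta>' $ i - \<delta> .. \<theta>' $ i + \<delta>}}"
      using h\<delta> by (auto simp: abs_le_iff) (smt (verit) h\<delta>)
    from tendsto_uniform_limitI[OF ul this]
    have "((\<lambda>\<alpha>. a \<alpha> * monomial \<alpha> (\<lambda>i. of_real (h $ i))) has_sum g (cis_vec (\<theta>' + h))) UNIV"
      by (simp add: has_sum_def)
    then show ?thesis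
      unfolding power_series_def using cis_vec_add_cong[OF \<theta>'] by (metis infsumI)
  qed
  ultimately show "\<exists>k>0. has_power_series k (\<lambda>x. g (cis_vec x)) \<theta>"
    unfolding has_power_series_def using k0 by blast
next
  assume "\<exists>k>0. has_power_series k (\<lambda>x. g (cis_vec x)) \<theta>"
  then obtain k a where k: "k > 0" and a: "a \<in> coeff_box k"
    and eq: "\<And>h::'a rvec. \<forall>i. \<bar>h $ i\<bar> \<le> 1 / (2 * real k) \<Longrightarrow>
               g (cis_vec (\<theta> + h)) = power_series a (\<lambda>i. of_real (h $ i))"
    unfolding has_power_series_def by blast
  define \<delta> where "\<delta> = 1 / (2 * real k)"
  define B where "B = {x. \<forall>i. x $ i \<in> {\<theta> $ i - \<delta> .. \<theta> $ i + \<delta>}}"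
  have small: "abs (x $ i - \<theta> $ i) \<le> 1 / (2 * real k)" if "x \<in> B" for x i
    using that by (auto simp: B_def \<delta>_def abs_le_iff algebra_simps)
  have "uniform_limit B (\<lambda>X x. \<Sum>\<alpha>\<in>X. a \<alpha> * monomial \<alpha> (\<lambda>i. of_real (x $ i - \<theta> $ i)))
          (\<lambda>x. power_series a (\<lambda>i. of_real (x $ i - \<theta> $ i))) (finite_subsets_at_top UNIV)"
    by (intro uniform_limit_power_series[OF k]) (use a small in \<open>auto simp del: of_real_diff\<close>)
  moreover have "g (cis_vec x) = power_series a (\<lambda>i. of_real (x $ i - \<theta> $ i))" if "x \<in> B" for x
    using eq[of "x - \<theta>"] small[OF that] by simp
  ultimately have "uniform_limit B (\<lambda>X x. \<Sum>\<alpha>\<in>X. a \<alpha> * monomial \<alpha> (\<lambda>i. of_real (x $ i - \<theta> $ i)))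
          (\<lambda>x. g (cis_vec x)) (finite_subsets_at_top UNIV)"
    by (subst uniform_limit_cong'[where g = "\<lambda>X x. \<Sum>\<alpha>\<in>X. a \<alpha> * monomial \<alpha> (\<lambda>i. of_real (x $ i - \<theta> $ i))"]) auto
  moreover have "(\<lambda>\<alpha>. norm (a \<alpha> * monomial \<alpha> (\<lambda>i. of_real (x $ i - \<theta> $ i)))) summable_on UNIV"
    if "x \<in> B" for x
    by (rule Infinite_Sum.abs_summable_on_comparison_test'[where g = "\<lambda>\<alpha>. real k * (1 / 2) ^ total_degree \<alpha>"])
       (use norm_term_le[OF a k] small[OF that] in
        \<open>auto intro!: summable_on_cmult_right geometric_summable simp del: of_real_diff\<close>)
  moreover have "\<delta> > 0" using k by (simp add: \<delta>_def)
  ultimately show "torus_real_analytic_at g (cis_vec \<theta>)"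
    unfolding torus_real_analytic_at_def Let_def monomial_def B_def by blast
qed

section \<open>Holomorphy along a coordinate\<close>

text \<open>
  A consequence of real analyticity that passes from the centre of a power series to all
  nearby points at once, with no expansion about the new centre.
\<close>
definition holomorphic_along :: "'n::finite \<Rightarrow> ('n rvec \<Rightarrow> complex) \<Rightarrow> 'n rvec \<Rightarrow> bool" where
  "holomorphic_along j F x \<longleftrightarrow> (\<exists>r>0. \<exists>H. H holomorphic_on ball 0 r \<and>
     (\<forall>s::real. \<bar>s\<bar> < r \<longrightarrow> H (of_real s) = F (x + s *\<^sub>R axis j 1)))"

lemma holomorphic_along_scaled_diff:
  assumes "holomorphic_along j F x" "holomorphic_along j G x"
  shows "holomorphic_along j (\<lambda>\<theta>. c * (F \<theta> - G \<theta>)) x"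
proof -
  obtain r H where H: "r > 0" "H holomorphic_on ball 0 r"
      "\<And>s. \<bar>s\<bar> < r \<Longrightarrow> H (of_real s) = F (x + s *\<^sub>R axis j 1)"
    using assms(1) unfolding holomorphic_along_def by blast
  obtain r' H' where H': "r' > 0" "H' holomorphic_on ball 0 r'"
      "\<And>s. \<bar>s\<bar> < r' \<Longrightarrow> H' (of_real s) = G (x + s *\<^sub>R axis j 1)"
    using assms(2) unfolding holomorphic_along_def by blast
  have "(\<lambda>z. c * (H z - H' z)) holomorphic_on ball 0 (min r r')"
    by (intro holomorphic_intros holomorphic_on_subset[OF H(2)] holomorphic_on_subset[OF H'(2)]) auto
  then show ?thesis
    unfolding holomorphic_along_def using H H'
    by (intro exI[of _ "min r r'"] exI[of _ "\<lambda>z. c * (H z - H' z)"] conjI) auto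
qed

text \<open>
  The power series converges on a complex polydisc, uniformly, and its partial sums are
  polynomials in the coordinate \<open>j\<close>. The conclusion holds at all nearby points \<open>x\<close>, with a
  radius that depends on \<open>k\<close> only.
\<close>
lemma has_power_series_imp_holomorphic_along:
  fixes x \<theta> :: "'n::finite rvec"
  assumes k: "k > 0" and ps: "has_power_series k F \<theta>"
    and x: "\<And>i. abs (x $ i - \<theta> $ i) \<le> 1 / (4 * real k)"
  shows "holomorphic_along j F x"
proof -
  obtain a where a: "a \<in> coeff_box k"
    and eq: "\<And>h. \<forall>i. \<bar>h $ i\<bar> \<le> 1 / (2 * real k) \<Longrightarrow>
               F (\<theta> + h) = power_series a (\<lambda>i. of_real (h $ i))"
    using ps unfolding has_power_series_def by blast
  define Z :: "complex \<Rightarrow> 'n \<Rightarrow> complex"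
    where "Z = (\<lambda>s i. of_real (x $ i - \<theta> $ i) + (if i = j then s else 0))"
  let ?r = "1 / (4 * real k)"
  have Z: "norm (Z s i) \<le> 1 / (2 * real k)" if "norm s \<le> ?r" for s i
  proof -
    have "norm (Z s i) \<le> ?r + ?r"
      unfolding Z_def by (rule order_trans[OF norm_triangle_ineq], rule add_mono)
        (use x that k in \<open>auto simp del: of_real_diff\<close>)
    then show ?thesis by simp
  qed
  have ul: "uniform_limit (cball 0 ?r) (\<lambda>X s. \<Sum>\<alpha>\<in>X. a \<alpha> * monomial \<alpha> (Z s))
              (\<lambda>s. power_series a (Z s)) (finite_subsets_at_top UNIV)"
    by (intro uniform_limit_power_series[OF k a] Z) auto
  have hol: "(\<lambda>s. \<Sum>\<alpha>\<in>X. a \<alpha> * monomial \<alpha> (Z s)) holomorphic_on UNIV" for X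
  proof -
    have "(\<lambda>s. Z s i) holomorphic_on UNIV" for i
      by (cases "i = j") (auto simp: Z_def intro!: holomorphic_intros)
    then show ?thesis
      unfolding monomial_def by (intro holomorphic_intros) auto
  qed
  have "(\<lambda>s. power_series a (Z s)) holomorphic_on ball 0 ?r"
  proof (rule holomorphic_uniform_limit[OF _ ul])
    show "\<forall>\<^sub>F X in finite_subsets_at_top UNIV.
        continuous_on (cball 0 ?r) (\<lambda>s. \<Sum>\<alpha>\<in>X. a \<alpha> * monomial \<alpha> (Z s)) \<and>
        (\<lambda>s. \<Sum>\<alpha>\<in>X. a \<alpha> * monomial \<alpha> (Z s)) holomorphic_on ball 0 ?r"
      by (intro always_eventually allI conjI holomorphic_on_imp_continuous_on
            holomorphic_on_subset[OF hol]) auto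
  qed auto
  moreover have "power_series a (Z (of_real s)) = F (x + s *\<^sub>R axis j 1)" if "\<bar>s\<bar> < ?r" for s
  proof -
    define h where "h = x - \<theta> + s *\<^sub>R axis j 1"
    have *: "complex_of_real (h $ i) = Z (of_real s) i" for i
      by (simp add: h_def Z_def axis_def)
    have "\<bar>h $ i\<bar> \<le> 1 / (2 * real k)" for i
      using Z[of "of_real s" i] that by (metis * less_eq_real_def norm_of_real)
    then have "F (\<theta> + h) = power_series a (\<lambda>i. of_real (h $ i))"
      by (intro eq) auto
    moreover have "\<theta> + h = x + s *\<^sub>R axis j 1"
      by (simp add: h_def)
    ultimately show ?thesis
      by (simp only: *)
  qed
  moreover have "?r > 0" using k by simp
  ultimately show ?thesis
    unfolding holomorphic_along_def by blast
qed

section \<open>A smooth lacunary series without holomorphic extension\<close>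

text \<open>
  This is the formal derivative of order \<open>m\<close> of the series
  \<open>\<Sum>\<^sub>k 2^(-k\<^sup>2) e^(i 2^k x)\<close>. The coefficients decay faster than every power of the
  frequencies \<open>2^k\<close>, so that all derivatives converge, but slowly enough for the derivatives
  to outgrow those of any analytic function.
\<close>
definition lacunary :: "nat \<Rightarrow> real \<Rightarrow> complex" where
  "lacunary m x = (\<Sum>k. (1 / 2) ^ k\<^sup>2 * (\<i> * 2 ^ k) ^ m * cis (2 ^ k * x))"

lemma norm_lacunary_term:
  "norm ((1 / 2) ^ k\<^sup>2 * (\<i> * 2 ^ k) ^ m * cis (2 ^ k * x)) = (1 / 2) ^ k\<^sup>2 * (2 ^ k) ^ m"
  by (simp add: norm_mult norm_power norm_divide)

lemma summable_lacunary_norm: "summable (\<lambda>k. (1 / 2 :: real) ^ k\<^sup>2 * (2 ^ k) ^ m)"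
proof (rule summable_comparison_test_ev)
  show "\<forall>\<^sub>F k in sequentially. norm ((1 / 2 :: real) ^ k\<^sup>2 * (2 ^ k) ^ m) \<le> (1 / 2) ^ k"
  proof (rule eventually_sequentiallyI)
    fix k assume k: "Suc m \<le> k"
    have "k * m + k \<le> k\<^sup>2"
      using mult_le_mono2[OF k, of k] by (simp add: power2_eq_square)
    then have "(2::real) ^ (k * m + k) \<le> 2 ^ k\<^sup>2"
      by (intro power_increasing) auto
    then show "norm ((1 / 2 :: real) ^ k\<^sup>2 * (2 ^ k) ^ m) \<le> (1 / 2) ^ k"
      by (simp add: field_simps power_mult power_add)
  qed
qed (auto intro: summable_geometric)

lemma summable_lacunary:
  "summable (\<lambda>k. (1 / 2) ^ k\<^sup>2 * (\<i> * 2 ^ k) ^ m * cis (2 ^ k * x))"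
  by (rule summable_norm_cancel) (simp only: norm_lacunary_term summable_lacunary_norm)

lemma lacunary_cis_cong:
  assumes "cis x = cis y"
  shows "lacunary 0 x = lacunary 0 y"
proof -
  have "cis (2 ^ k * x) = cis (2 ^ k * y)" for k
    using Complex.DeMoivre[of x "2 ^ k"] Complex.DeMoivre[of y "2 ^ k"] assms by simp
  then show ?thesis
    by (simp add: lacunary_def)
qed

lemma has_vector_derivative_lacunary:
  "(lacunary m has_vector_derivative lacunary (Suc m) x) (at x)"
proof -
  let ?t = "\<lambda>m k x. (1 / 2) ^ k\<^sup>2 * (\<i> * 2 ^ k) ^ m * cis (2 ^ k * x)"
  have deriv: "((\<lambda>x. ?t m k x) has_derivative (\<lambda>h. h *\<^sub>R ?t (Suc m) k x)) (at x)" for k x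
  proof -
    have "((\<lambda>x. cis (2 ^ k * x)) has_vector_derivative 2 ^ k *\<^sub>R (\<i> * cis (2 ^ k * x))) (at x)"
      unfolding has_vector_derivative_def
      by (rule has_derivative_eq_rhs[OF has_derivative_cis]) (auto intro!: derivative_eq_intros)
    then have "((\<lambda>x. ?t m k x) has_vector_derivative
                 (1 / 2) ^ k\<^sup>2 * (\<i> * 2 ^ k) ^ m * (2 ^ k *\<^sub>R (\<i> * cis (2 ^ k * x)))) (at x)"
      by (rule has_vector_derivative_mult_right)
    then show ?thesis
      by (simp add: has_vector_derivative_def scaleR_conv_of_real mult_ac)
  qed
  have "uniform_limit UNIV (\<lambda>n x. \<Sum>k<n. ?t (Suc m) k x) (lacunary (Suc m)) sequentially"
    unfolding lacunary_def
    by (rule Weierstrass_m_test[OF _ summable_lacunary_norm[of "Suc m"]]) (simp only: norm_lacunary_term order_refl)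
  then have unif: "\<forall>\<^sub>F n in sequentially. \<forall>x\<in>UNIV. \<forall>h.
      norm ((\<Sum>k<n. h *\<^sub>R ?t (Suc m) k x) - h *\<^sub>R lacunary (Suc m) x) \<le> e * norm h" if "e > 0" for e
  proof (rule eventually_mono[OF uniform_limitD[OF _ that]])
    fix n assume *: "\<forall>x\<in>UNIV. dist (\<Sum>k<n. ?t (Suc m) k x) (lacunary (Suc m) x) < e"
    show "\<forall>x\<in>UNIV. \<forall>h.
      norm ((\<Sum>k<n. h *\<^sub>R ?t (Suc m) k x) - h *\<^sub>R lacunary (Suc m) x) \<le> e * norm h"
    proof (intro ballI allI)
      fix x h :: real
      have "norm ((\<Sum>k<n. h *\<^sub>R ?t (Suc m) k x) - h *\<^sub>R lacunary (Suc m) x) =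
            norm h * dist (\<Sum>k<n. ?t (Suc m) k x) (lacunary (Suc m) x)"
        by (simp only: dist_norm norm_scaleR real_norm_def
              flip: scaleR_sum_right scaleR_right_diff_distrib)
      also have "\<dots> \<le> norm h * e"
        using * by (intro mult_left_mono) (auto intro: less_imp_le)
      finally show "norm ((\<Sum>k<n. h *\<^sub>R ?t (Suc m) k x) - h *\<^sub>R lacunary (Suc m) x) \<le> e * norm h"
        by (simp add: mult.commute)
    qed
  qed
  obtain g where g: "\<And>x. (\<lambda>k. ?t m k x) sums g x"
      "\<And>x. (g has_derivative (\<lambda>h. h *\<^sub>R lacunary (Suc m) x)) (at x)"
    using has_derivative_series[OF convex_UNIV deriv unif UNIV_I summable_sums[OF summable_lacunary]]
    by auto
  have "g = lacunary m"
    using g(1) by (auto simp: lacunary_def sums_iff)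
  then show ?thesis
    using g(2) by (simp add: has_vector_derivative_def)
qed

text \<open>
  At a dyadic multiple of \<open>2\<pi>\<close> all terms from index \<open>l\<close> on have the same argument, so that
  nothing cancels among them. The term with index \<open>N\<close> of the derivative of order \<open>2 N\<close> has
  modulus \<open>2^(2 N\<^sup>2 - N\<^sup>2)\<close>; the first \<open>l\<close> terms contribute at most
  \<open>l (2^l)^(2 N)\<close>.
\<close>
lemma norm_lacunary_ge:
  assumes x: "x = 2 * pi * of_int j / 2 ^ l" and N: "l \<le> N"
  shows "2 ^ N\<^sup>2 - real l * (2 ^ l) ^ (2 * N) \<le> norm (lacunary (2 * N) x)"
proof -
  let ?t = "\<lambda>k. (1 / 2) ^ k\<^sup>2 * (\<i> * 2 ^ k) ^ (2 * N) * cis (2 ^ k * x)"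
  let ?c = "\<lambda>k. (1 / 2 :: real) ^ k\<^sup>2 * (2 ^ k) ^ (2 * N)"
  have aligned: "cis (2 ^ k * x) = 1" if "l \<le> k" for k
  proof -
    have "2 ^ k * x = 2 * pi * of_int (2 ^ (k - l) * j)"
    proof -
      have "(2::real) ^ k = 2 ^ (k - l) * 2 ^ l"
        using that by (simp flip: power_add)
      then show ?thesis
        by (simp add: x)
    qed
    then show ?thesis
      by (simp add: cis_multiple_2pi)
  qed
  have "?c N = 2 ^ N\<^sup>2"
  proof -
    have "(2::real) ^ (N * (2 * N)) = 2 ^ N\<^sup>2 * 2 ^ N\<^sup>2"
      by (simp add: power2_eq_square flip: power_add)
    then show ?thesis
      by (simp add: power_divide flip: power_mult)
  qed
  then have "2 ^ N\<^sup>2 = (\<Sum>k\<in>{N - l}. ?c (k + l))"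
    using N by simp
  also have "\<dots> \<le> (\<Sum>k. ?c (k + l))"
    by (intro sum_le_suminf summable_ignore_initial_segment[OF summable_lacunary_norm]) auto
  also have "\<dots> \<le> norm (\<Sum>k. ?t (k + l))"
  proof -
    have "(\<Sum>k. ?t (k + l)) = (\<Sum>k. \<i> ^ (2 * N) * of_real (?c (k + l)))"
      by (intro suminf_cong) (simp add: aligned power_mult_distrib)
    also have "\<dots> = \<i> ^ (2 * N) * of_real (\<Sum>k. ?c (k + l))"
    proof -
      have sm: "summable (\<lambda>k. ?c (k + l))"
        by (rule summable_ignore_initial_segment[OF summable_lacunary_norm])
      show ?thesis
        by (subst suminf_mult[OF summable_of_real[OF sm]])
           (simp only: bounded_linear.suminf[OF bounded_linear_of_real sm])
    qed
    finally show ?thesis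
      by (simp add: norm_mult norm_power)
  qed
  also have "(\<Sum>k. ?t (k + l)) = lacunary (2 * N) x - (\<Sum>k<l. ?t k)"
    unfolding lacunary_def by (rule suminf_minus_initial_segment[OF summable_lacunary])
  also have "norm \<dots> \<le> norm (lacunary (2 * N) x) + norm (\<Sum>k<l. ?t k)"
    by (rule norm_triangle_ineq4)
  also have "norm (\<Sum>k<l. ?t k) \<le> (\<Sum>k<l. (2 ^ l) ^ (2 * N))"
  proof (rule sum_norm_le)
    fix k assume "k \<in> {..<l}"
    then have "(2::real) ^ k \<le> 2 ^ l"
      by (intro power_increasing) auto
    then have "?c k \<le> 1 * (2 ^ l) ^ (2 * N)"
      by (intro mult_mono power_mono power_le_one) auto
    then show "norm (?t k) \<le> (2 ^ l) ^ (2 * N)"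
      by (simp only: norm_lacunary_term mult_1)
  qed
  finally show ?thesis
    by simp
qed

text \<open>
  With \<open>D = C + 2 / \<rho>\<close> and \<open>N \<ge> 1\<close> the left-hand side is at most a constant times \<open>(D N)^(2 N)\<close>, and
  \<open>(D N)\<^sup>2\<close> is eventually smaller than \<open>2^N / 2\<close>.
\<close>
lemma exceeds_factorial_growth:
  fixes A B C \<rho> :: real
  assumes "\<rho> > 0" "C > 0"
  shows "\<exists>N\<ge>l. A * C ^ (2 * N) + fact (2 * N) * B / \<rho> ^ (2 * N) < 2 ^ N\<^sup>2"
proof -
  define D where "D = C + 2 / \<rho>"
  have D: "D > 0" using assms by (simp add: D_def add_pos_pos)
  have "(\<lambda>N. (D * real N)\<^sup>2 / 2 ^ N) \<longlonglongrightarrow> 0"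
    using D by real_asymp
  then have "\<forall>\<^sub>F N in sequentially. (D * real N)\<^sup>2 / 2 ^ N < 1 / 2"
    by (rule order_tendstoD) simp
  moreover have "filterlim (\<lambda>N. 2 ^ N :: real) at_top sequentially"
    by real_asymp
  then have "\<forall>\<^sub>F N in sequentially. \<bar>A\<bar> + \<bar>B\<bar> < 2 ^ N"
    by (simp add: filterlim_at_top_dense)
  ultimately have "\<forall>\<^sub>F N in sequentially. (D * real N)\<^sup>2 / 2 ^ N < 1 / 2 \<and>
      \<bar>A\<bar> + \<bar>B\<bar> < 2 ^ N \<and> N \<ge> max l 1"
    by (intro eventually_conj eventually_ge_at_top)
  then obtain N where DN: "(D * real N)\<^sup>2 / 2 ^ N < 1 / 2" and AB: "\<bar>A\<bar> + \<bar>B\<bar> < 2 ^ N"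
    and N: "N \<ge> l" "N \<ge> 1"
    by (metis (mono_tags, lifting) eventually_happens' sequentially_bot max.boundedE)
  let ?X = "(D * real N) ^ (2 * N)"
  have "A * C ^ (2 * N) \<le> \<bar>A\<bar> * ?X"
  proof (intro mult_mono power_mono)
    have "C * 1 \<le> D * real N"
      using assms N by (intro mult_mono) (auto simp: D_def)
    then show "C \<le> D * real N" by simp
  qed (use assms in auto)
  moreover have "fact (2 * N) * B / \<rho> ^ (2 * N) \<le> \<bar>B\<bar> * ?X"
  proof -
    have "fact (2 * N) / \<rho> ^ (2 * N) \<le> (2 * real N) ^ (2 * N) / \<rho> ^ (2 * N)"
      using fact_le_power[of "2 * N", where ?'a = real] assms
      by (intro divide_right_mono) auto
    also have "\<dots> = (2 * real N / \<rho>) ^ (2 * N)"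
      by (simp add: power_divide)
    also have "\<dots> \<le> ?X"
    proof (rule power_mono)
      have "2 / \<rho> * real N \<le> D * real N"
        using assms by (intro mult_right_mono) (auto simp: D_def)
      then show "2 * real N / \<rho> \<le> D * real N" by simp
    qed (use assms in auto)
    finally have "B * (fact (2 * N) / \<rho> ^ (2 * N)) \<le> \<bar>B\<bar> * ?X"
      using assms by (intro mult_mono) auto
    then show ?thesis
      by (simp add: mult.commute)
  qed
  ultimately have "A * C ^ (2 * N) + fact (2 * N) * B / \<rho> ^ (2 * N) \<le> (\<bar>A\<bar> + \<bar>B\<bar>) * ?X"
    by (simp add: distrib_right)
  also have "\<dots> < 2 ^ N * ?X"
    using AB D N by (intro mult_strict_right_mono) auto
  also have "?X = ((D * real N)\<^sup>2) ^ N"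
    by (simp add: power_mult)
  also have "\<dots> \<le> (2 ^ N / 2) ^ N"
    using DN by (intro power_mono) (auto simp: field_simps)
  also have "2 ^ N * (2 ^ N / 2 :: real) ^ N = 2 ^ N\<^sup>2"
    by (simp add: power_divide power2_eq_square flip: power_mult)
  finally show ?thesis
    using N by auto
qed

lemma dense_dyadic_angles:
  assumes "(0::real) < r"
  obtains j l where "\<bar>2 * pi * of_int j / 2 ^ l - y\<bar> < r"
proof -
  obtain l where l: "(1 / 2) ^ l < r / (2 * pi)"
    using real_arch_pow_inv[of "r / (2 * pi)" "1 / 2"] assms by auto
  define j where "j = \<lfloor>y / (2 * pi) * 2 ^ l\<rfloor>"
  have "\<bar>of_int j - y / (2 * pi) * 2 ^ l\<bar> < 1"
    unfolding j_def by linarith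
  then have "\<bar>of_int j - y / (2 * pi) * 2 ^ l\<bar> * (2 * pi / 2 ^ l) < 1 * (2 * pi / 2 ^ l)"
    by (intro mult_strict_right_mono) auto
  also have "\<bar>of_int j - y / (2 * pi) * 2 ^ l\<bar> * (2 * pi / 2 ^ l) =
               \<bar>(of_int j - y / (2 * pi) * 2 ^ l) * (2 * pi / 2 ^ l)\<bar>"
    by (simp add: abs_mult)
  also have "(of_int j - y / (2 * pi) * 2 ^ l) * (2 * pi / 2 ^ l) = 2 * pi * of_int j / 2 ^ l - y"
    by (simp add: field_simps)
  also have "1 * (2 * pi / 2 ^ l) < r"
    using l by (simp add: field_simps power_divide)
  finally show thesis ..
qed

text \<open>
  Near every real point there is a dyadic multiple of \<open>2\<pi>\<close>. There the derivatives of a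
  holomorphic extension would obey Cauchy's estimate, which the lower bound on the
  derivatives of the series contradicts.
\<close>
lemma lacunary_no_holomorphic_extension:
  assumes r: "r > 0" and hol: "H holomorphic_on ball 0 r"
    and eq: "\<And>s. \<bar>s\<bar> < r \<Longrightarrow> H (of_real s) = lacunary 0 (y + s)"
  shows False
proof -
  have derivs: "(deriv ^^ n) H (of_real s) = lacunary n (y + s)" if "\<bar>s\<bar> < r" for n s
    using that
  proof (induction n arbitrary: s)
    case (Suc n)
    have "(deriv ^^ n) H holomorphic_on ball 0 r"
      by (rule holomorphic_higher_deriv[OF hol]) auto
    then have "((deriv ^^ n) H has_field_derivative (deriv ^^ Suc n) H (of_real s)) (at (of_real s))"
      using Suc.prems by (auto intro!: holomorphic_derivI[of _ "ball 0 r"])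
    then have 1: "((\<lambda>s. (deriv ^^ n) H (of_real s)) has_vector_derivative
              (deriv ^^ Suc n) H (of_real s)) (at s)"
      using has_vector_derivative_real_field by blast
    have "((\<lambda>s. lacunary n (y + s)) has_vector_derivative lacunary (Suc n) (y + s)) (at s)"
    proof -
      have "((\<lambda>s. y + s) has_vector_derivative 1) (at s)"
        by (auto simp: has_vector_derivative_def intro!: derivative_eq_intros)
      from vector_diff_chain_at[OF this has_vector_derivative_lacunary] show ?thesis
        by (simp add: o_def)
    qed
    then have "((\<lambda>s. (deriv ^^ n) H (of_real s)) has_vector_derivative lacunary (Suc n) (y + s)) (at s)"
    proof (rule has_vector_derivative_transform_within_open)
      show "open {-r<..<r}" "s \<in> {-r<..<r}" using Suc.prems by auto
    qed (use Suc.IH in auto)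
    with 1 show ?case
      using vector_derivative_unique_at by blast
  qed (use eq in auto)
  \<comment> \<open>The dyadic point is kept within half the radius, so that the disc for Cauchy's estimate fits.\<close>
  obtain j l where jl: "\<bar>2 * pi * of_int j / 2 ^ l - y\<bar> < r / 2"
    using dense_dyadic_angles[of "r / 2" y] r by auto
  define s where "s = 2 * pi * of_int j / 2 ^ l - y"
  define \<rho> where "\<rho> = r / 2"
  have sub: "cball (complex_of_real s) \<rho> \<subseteq> ball 0 r"
  proof
    fix z assume "z \<in> cball (complex_of_real s) \<rho>"
    then have "norm (z - of_real s) \<le> r / 2"
      by (simp add: \<rho>_def dist_norm norm_minus_commute)
    moreover have "norm (complex_of_real s) < r / 2"
      using jl unfolding s_def norm_of_real .
    ultimately show "z \<in> ball 0 r"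
      using norm_triangle_ineq[of "z - of_real s" "of_real s"] by simp
  qed
  have cont: "continuous_on (cball (of_real s) \<rho>) H"
    using hol sub by (metis holomorphic_on_imp_continuous_on holomorphic_on_subset)
  then have "bounded (H ` cball (of_real s) \<rho>)"
    by (intro compact_imp_bounded compact_continuous_image) auto
  then obtain B where B: "\<And>z. z \<in> cball (of_real s) \<rho> \<Longrightarrow> norm (H z) \<le> B"
    unfolding bounded_iff by (metis imageI)
  have upper: "norm (lacunary n (y + s)) \<le> fact n * B / \<rho> ^ n" for n
  proof -
    have "norm ((deriv ^^ n) H (of_real s)) \<le> fact n * B / \<rho> ^ n"
    proof (rule Cauchy_inequality[OF _ cont])
      show "H holomorphic_on ball (of_real s) \<rho>"
        by (rule holomorphic_on_subset[OF hol]) (use sub ball_subset_cball in blast)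
    qed (use r B in \<open>auto simp: \<rho>_def dist_norm\<close>)
    then show ?thesis
      using derivs[of s n] jl r by (simp add: s_def)
  qed
  obtain N where N: "l \<le> N"
    and lt: "real l * (2 ^ l) ^ (2 * N) + fact (2 * N) * B / \<rho> ^ (2 * N) < 2 ^ N\<^sup>2"
  proof -
    have "0 < \<rho>" "(0::real) < 2 ^ l" using r by (auto simp: \<rho>_def)
    from exceeds_factorial_growth[OF this, of l "real l" B] show thesis
      using that by blast
  qed
  have "y + s = 2 * pi * of_int j / 2 ^ l"
    by (simp add: s_def)
  then have ge: "2 ^ N\<^sup>2 - real l * (2 ^ l) ^ (2 * N) \<le> fact (2 * N) * B / \<rho> ^ (2 * N)"
    by (rule order_trans[OF norm_lacunary_ge[OF _ N] upper])
  have "False" if "a + b < c" "c - a \<le> b" for a b c :: real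
    using that by simp
  from this[OF lt ge] show False .
qed

section \<open>Mixed derivatives in the angles\<close>

definition Cp_angles :: "enat \<Rightarrow> ('n::{finite,linorder} rvec \<Rightarrow> complex) \<Rightarrow> bool" where
  "Cp_angles p F \<longleftrightarrow>
     (\<forall>\<alpha> j. mi_order \<alpha> < p \<and> (\<forall>i<j. \<alpha> i = 0) \<longrightarrow> partial_differentiable j (multi_deriv \<alpha> F)) \<and>
     (\<forall>\<alpha>. mi_order \<alpha> \<le> p \<longrightarrow> continuous_on UNIV (multi_deriv \<alpha> F))"

lemma Cp_torus_iff: "Cp_torus p g \<longleftrightarrow> Cp_angles p (\<lambda>\<theta>. g (cis_vec \<theta>))"
  by (simp add: Cp_torus_def Cp_angles_def)

text \<open>
  Every multi-index is reached from zero by raising entries from the largest index down to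
  the smallest, which is the order in which the derivatives are taken.
\<close>
definition raise :: "'n \<Rightarrow> ('n \<Rightarrow> nat) \<Rightarrow> 'n \<Rightarrow> nat" where
  "raise j \<alpha> = \<alpha>(j := Suc (\<alpha> j))"

lemma multi_deriv_0: "multi_deriv (\<lambda>_. 0) F = F"
proof -
  have "foldr (\<lambda>j. partial_deriv j ^^ 0) js F = F" for js :: "'a list"
    by (induction js) auto
  then show ?thesis
    by (simp add: multi_deriv_def)
qed

lemma multi_deriv_raise:
  fixes j :: "'n::{finite,linorder}"
  assumes "\<forall>i<j. \<alpha> i = 0"
  shows "multi_deriv (raise j \<alpha>) F = partial_deriv j (multi_deriv \<alpha> F)"
proof -
  have "j \<in> set (sorted_list_of_set UNIV)" by simp
  then obtain xs ys where split: "sorted_list_of_set UNIV = xs @ j # ys"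
    by (meson split_list)
  have "sorted_wrt (<) (xs @ j # ys)"
    using strict_sorted_list_of_set[of "UNIV :: 'n set"] by (simp add: split)
  then have xs: "\<And>i. i \<in> set xs \<Longrightarrow> i < j" and ys: "j \<notin> set ys"
    by (auto simp: sorted_wrt_append)
  have skip: "foldr (\<lambda>j. partial_deriv j ^^ \<beta> j) xs G = G"
    if "\<And>i. i \<in> set xs \<Longrightarrow> \<beta> i = 0" for \<beta> G
    using that by (induction xs) auto
  have "foldr (\<lambda>i. partial_deriv i ^^ raise j \<alpha> i) ys F = foldr (\<lambda>i. partial_deriv i ^^ \<alpha> i) ys F"
    using ys by (intro foldr_cong) (auto simp: raise_def)
  moreover have "raise j \<alpha> i = 0" "\<alpha> i = 0" if "i \<in> set xs" for i
    using xs[OF that] assms by (auto simp: raise_def)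
  ultimately show ?thesis
    unfolding multi_deriv_def split by (simp add: skip) (simp add: raise_def)
qed

lemma mi_order_0: "mi_order (\<lambda>_. 0) = 0"
  by (simp add: mi_order_def zero_enat_def)

lemma mi_order_raise: "mi_order (raise j \<alpha>) = eSuc (mi_order \<alpha>)"
proof -
  have "(\<Sum>i\<in>UNIV. raise j \<alpha> i) = (\<Sum>i\<in>UNIV. \<alpha> i + (if i = j then 1 else 0))"
    by (intro sum.cong) (auto simp: raise_def)
  also have "\<dots> = Suc (\<Sum>i\<in>UNIV. \<alpha> i)"
    by (simp add: sum.distrib)
  finally show ?thesis
    by (simp add: mi_order_def eSuc_enat)
qed

lemma mi_order_raise_le: "mi_order (raise j \<alpha>) \<le> p \<Longrightarrow> mi_order \<alpha> < p"
  unfolding mi_order_raise by (simp add: mi_order_def eSuc_enat Suc_ile_eq)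

lemma multi_index_induct [case_names zero raise]:
  fixes \<alpha> :: "'n::{finite,linorder} \<Rightarrow> nat"
  assumes "P (\<lambda>_. 0)"
    and "\<And>\<alpha> j. \<forall>i<j. \<alpha> i = 0 \<Longrightarrow> P \<alpha> \<Longrightarrow> P (raise j \<alpha>)"
  shows "P \<alpha>"
proof (induction "\<Sum>i\<in>UNIV. \<alpha> i" arbitrary: \<alpha>)
  case 0
  then have "\<alpha> = (\<lambda>_. 0)" by auto
  then show ?case using assms(1) by simp
next
  case (Suc n)
  define j where "j = Min {i. \<alpha> i \<noteq> 0}"
  have ne: "{i. \<alpha> i \<noteq> 0} \<noteq> {}" using Suc.hyps(2) by (metis (mono_tags, lifting) Collect_empty_eq old.nat.distinct(2) sum.neutral)
  then have j: "\<alpha> j \<noteq> 0" using Min_in[OF _ ne] by (auto simp: j_def)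
  have below: "\<forall>i<j. \<alpha> i = 0"
    unfolding j_def by (metis (mono_tags) Min_le finite leD mem_Collect_eq)
  define \<beta> where "\<beta> = \<alpha>(j := \<alpha> j - 1)"
  have \<alpha>: "\<alpha> = raise j \<beta>" using j by (auto simp: \<beta>_def raise_def)
  have "eSuc (mi_order \<beta>) = mi_order \<alpha>" by (simp add: \<alpha> mi_order_raise)
  then have "n = (\<Sum>i\<in>UNIV. \<beta> i)"
    using Suc.hyps(2) by (simp add: mi_order_def eSuc_enat)
  then have "P \<beta>" by (rule Suc.hyps(1))
  moreover have "\<forall>i<j. \<beta> i = 0" using below by (auto simp: \<beta>_def)
  ultimately show ?case unfolding \<alpha> by (intro assms(2))
qed

lemma partial_deriv_linear:
  assumes "partial_differentiable j F" "partial_differentiable j G"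
  shows "partial_deriv j (\<lambda>\<theta>. F \<theta> + c * G \<theta>) = (\<lambda>\<theta>. partial_deriv j F \<theta> + c * partial_deriv j G \<theta>)"
    and "partial_differentiable j (\<lambda>\<theta>. F \<theta> + c * G \<theta>)"
proof -
  have *: "((\<lambda>s. F (\<theta> + s *\<^sub>R axis j 1) + c * G (\<theta> + s *\<^sub>R axis j 1)) has_vector_derivative
          partial_deriv j F \<theta> + c * partial_deriv j G \<theta>) (at 0)" for \<theta>
    using assms unfolding partial_differentiable_def partial_deriv_def
    by (intro has_vector_derivative_add has_vector_derivative_mult_right)
       (auto simp: vector_derivative_works)
  show "partial_deriv j (\<lambda>\<theta>. F \<theta> + c * G \<theta>) = (\<lambda>\<theta>. partial_deriv j F \<theta> + c * partial_deriv j G \<theta>)"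
    unfolding partial_deriv_def[of j "\<lambda>\<theta>. F \<theta> + c * G \<theta>"] using vector_derivative_at[OF *] by auto
  show "partial_differentiable j (\<lambda>\<theta>. F \<theta> + c * G \<theta>)"
    unfolding partial_differentiable_def using * differentiableI_vector by blast
qed

lemma multi_deriv_linear:
  assumes F: "Cp_angles p F" and G: "Cp_angles p G" and \<alpha>: "mi_order \<alpha> \<le> p"
  shows "multi_deriv \<alpha> (\<lambda>\<theta>. F \<theta> + c * G \<theta>) = (\<lambda>\<theta>. multi_deriv \<alpha> F \<theta> + c * multi_deriv \<alpha> G \<theta>)"
  using \<alpha>
proof (induction \<alpha> rule: multi_index_induct)
  case (raise \<alpha> j)
  have lt: "mi_order \<alpha> < p"
    using raise.prems by (rule mi_order_raise_le)
  have "partial_differentiable j (multi_deriv \<alpha> F)" "partial_differentiable j (multi_deriv \<alpha> G)"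
    using F G raise.hyps lt by (auto simp: Cp_angles_def)
  then show ?case
    using raise.IH lt by (simp add: multi_deriv_raise[OF raise.hyps] partial_deriv_linear)
qed (simp add: multi_deriv_0)

lemma Cp_angles_linear:
  assumes F: "Cp_angles p F" and G: "Cp_angles p G"
  shows "Cp_angles p (\<lambda>\<theta>. F \<theta> + c * G \<theta>)"
  unfolding Cp_angles_def
proof (intro conjI allI impI)
  fix \<alpha> :: "'a \<Rightarrow> nat" and j
  assume *: "mi_order \<alpha> < p \<and> (\<forall>i<j. \<alpha> i = 0)"
  then show "partial_differentiable j (multi_deriv \<alpha> (\<lambda>\<theta>. F \<theta> + c * G \<theta>))"
    using F G by (subst multi_deriv_linear[OF F G]) (auto simp: Cp_angles_def intro!: partial_deriv_linear(2))
next
  fix \<alpha> :: "'a \<Rightarrow> nat"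
  assume "mi_order \<alpha> \<le> p"
  then show "continuous_on UNIV (multi_deriv \<alpha> (\<lambda>\<theta>. F \<theta> + c * G \<theta>))"
    using F G by (subst multi_deriv_linear[OF F G]) (auto simp: Cp_angles_def intro!: continuous_intros)
qed

lemma multi_deriv_periodic:
  assumes "\<And>\<theta>. F (\<theta> + v) = F \<theta>"
  shows "multi_deriv \<alpha> F (\<theta> + v) = multi_deriv \<alpha> F \<theta>"
proof (induction \<alpha> arbitrary: \<theta> rule: multi_index_induct)
  case (raise \<alpha> j)
  have "multi_deriv \<alpha> F (\<theta> + v + s *\<^sub>R axis j 1) = multi_deriv \<alpha> F (\<theta> + s *\<^sub>R axis j 1)" for s
    using raise.IH[of "\<theta> + s *\<^sub>R axis j 1"] by (simp add: add_ac)
  then show ?case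
    by (simp add: multi_deriv_raise[OF raise.hyps] partial_deriv_def)
qed (use assms in \<open>simp add: multi_deriv_0\<close>)

lemma exists_angles_in_box:
  obtains \<theta>' where "\<theta>' \<in> cbox (0 :: 'n::finite rvec) (\<chi> i. 2 * pi)" "cis_vec \<theta>' = cis_vec \<theta>"
proof
  define \<theta>' :: "'n rvec" where "\<theta>' = (\<chi> i. \<theta> $ i - 2 * pi * of_int \<lfloor>\<theta> $ i / (2 * pi)\<rfloor>)"
  have "0 \<le> \<theta>' $ i \<and> \<theta>' $ i \<le> 2 * pi" for i
  proof -
    define N where "N = \<lfloor>\<theta> $ i / (2 * pi)\<rfloor>"
    have "of_int N \<le> \<theta> $ i / (2 * pi)" "\<theta> $ i / (2 * pi) \<le> of_int N + 1"
      unfolding N_def by linarith+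
    then show ?thesis
      unfolding \<theta>'_def vec_lambda_beta N_def[symmetric] by (simp add: field_simps)
  qed
  then show "\<theta>' \<in> cbox 0 (\<chi> i. 2 * pi)"
    by (simp add: mem_box_cart)
  have "cis (\<theta> $ i - 2 * pi * of_int \<lfloor>\<theta> $ i / (2 * pi)\<rfloor>) = cis (\<theta> $ i)" for i
    by (simp add: cis_multiple_2pi flip: cis_divide)
  then show "cis_vec \<theta>' = cis_vec \<theta>"
    by (simp add: cis_vec_def \<theta>'_def)
qed

text \<open>
  The derivatives of a periodic function are periodic, so that the bound on one period
  suffices. It is what makes the suprema in the seminorms meaningful.
\<close>
lemma bounded_multi_deriv:
  assumes F: "Cp_angles p (\<lambda>\<theta>. g (cis_vec \<theta>))" and \<alpha>: "mi_order \<alpha> \<le> p"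
  shows "bdd_above (range (\<lambda>\<theta>. cmod (multi_deriv \<alpha> (\<lambda>\<theta>. g (cis_vec \<theta>)) \<theta>)))"
proof -
  let ?G = "multi_deriv \<alpha> (\<lambda>\<theta>. g (cis_vec \<theta>))"
  let ?K = "cbox (0 :: 'a rvec) (\<chi> i. 2 * pi)"
  have "continuous_on ?K ?G"
    using F \<alpha> by (auto simp: Cp_angles_def intro: continuous_on_subset)
  then have "bounded (?G ` ?K)"
    by (intro compact_imp_bounded compact_continuous_image) auto
  then obtain B where B: "\<And>\<theta>. \<theta> \<in> ?K \<Longrightarrow> cmod (?G \<theta>) \<le> B"
    by (auto simp: bounded_iff)
  have "cmod (?G \<theta>) \<le> B" for \<theta>
  proof -
    obtain \<theta>' where \<theta>': "\<theta>' \<in> ?K" "cis_vec \<theta>' = cis_vec \<theta>"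
      by (rule exists_angles_in_box)
    have "g (cis_vec (x + (\<theta> - \<theta>'))) = g (cis_vec x)" for x
      using cis_vec_add_cong[OF \<theta>'(2), of "x - \<theta>'"] by (simp add: algebra_simps)
    from multi_deriv_periodic[of "\<lambda>x. g (cis_vec x)", OF this, of \<alpha> \<theta>'] B[OF \<theta>'(1)]
    show ?thesis by simp
  qed
  then show ?thesis by (auto simp: bdd_above_def)
qed

lemma partial_deriv_lacunary:
  "partial_deriv i (\<lambda>\<theta>. lacunary m (\<theta> $ j)) = (\<lambda>\<theta>. if i = j then lacunary (Suc m) (\<theta> $ j) else 0)"
  "partial_differentiable i (\<lambda>\<theta>. lacunary m (\<theta> $ j))"
proof -
  have *: "((\<lambda>s. lacunary m ((\<theta> + s *\<^sub>R axis i 1) $ j)) has_vector_derivative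
             (if i = j then lacunary (Suc m) (\<theta> $ j) else 0)) (at 0)" for \<theta>
  proof (cases "i = j")
    case True
    have "((\<lambda>s. \<theta> $ j + s) has_vector_derivative 1) (at 0)"
      by (auto simp: has_vector_derivative_def intro!: derivative_eq_intros)
    from vector_diff_chain_at[OF this has_vector_derivative_lacunary[of m]] True show ?thesis
      by (simp add: o_def axis_def)
  qed (simp add: axis_def)
  show "partial_deriv i (\<lambda>\<theta>. lacunary m (\<theta> $ j)) = (\<lambda>\<theta>. if i = j then lacunary (Suc m) (\<theta> $ j) else 0)"
    unfolding partial_deriv_def using vector_derivative_at[OF *] by auto
  show "partial_differentiable i (\<lambda>\<theta>. lacunary m (\<theta> $ j))"
    unfolding partial_differentiable_def using * differentiableI_vector by blast
qed

text \<open>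
  Differentiating in the coordinate \<open>j\<close> passes to the next lacunary series; any other
  coordinate gives zero.
\<close>
lemma multi_deriv_lacunary:
  "multi_deriv \<alpha> (\<lambda>\<theta>. lacunary 0 (\<theta> $ j)) \<in> insert (\<lambda>_. 0) (range (\<lambda>m \<theta>. lacunary m (\<theta> $ j)))"
proof (induction \<alpha> rule: multi_index_induct)
  case (raise \<alpha> i)
  have "partial_deriv i (\<lambda>_. 0) = (\<lambda>_. 0)"
    by (simp add: partial_deriv_def fun_eq_iff)
  with raise.IH show ?case
    unfolding multi_deriv_raise[OF raise.hyps] by (cases "i = j") (auto simp: partial_deriv_lacunary)
qed (auto simp: multi_deriv_0)

lemma continuous_on_lacunary: "continuous_on A (lacunary m)"
  using has_vector_derivative_lacunary
  by (meson continuous_at_imp_continuous_on has_vector_derivative_continuous)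

lemma Cp_angles_lacunary: "Cp_angles p (\<lambda>\<theta>. lacunary 0 (\<theta> $ j))"
  unfolding Cp_angles_def
proof (intro conjI allI impI)
  fix \<alpha> :: "'a \<Rightarrow> nat" and i :: 'a
  have "partial_differentiable i (\<lambda>_. 0)"
    by (simp add: partial_differentiable_def)
  then show "partial_differentiable i (multi_deriv \<alpha> (\<lambda>\<theta>. lacunary 0 (\<theta> $ j)))"
    using multi_deriv_lacunary[of \<alpha> j] partial_deriv_lacunary(2) by auto
  show "continuous_on UNIV (multi_deriv \<alpha> (\<lambda>\<theta>. lacunary 0 (\<theta> $ j)))"
    using multi_deriv_lacunary[of \<alpha> j]
    by (auto intro!: continuous_on_compose2[OF continuous_on_lacunary[of UNIV]] continuous_intros)
qed

lemma not_holomorphic_along_lacunary: "\<not> holomorphic_along j (\<lambda>\<theta>. lacunary 0 (\<theta> $ j)) x"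
proof
  assume "holomorphic_along j (\<lambda>\<theta>. lacunary 0 (\<theta> $ j)) x"
  then obtain r H where "r > 0" "H holomorphic_on ball 0 r"
      "\<And>s. \<bar>s\<bar> < r \<Longrightarrow> H (of_real s) = lacunary 0 (x $ j + s)"
    unfolding holomorphic_along_def by (auto simp: axis_def)
  then show False
    by (rule lacunary_no_holomorphic_extension)
qed

section \<open>The topology of the function space\<close>

abbreviation pullback ::
    "('n::finite cvec \<Rightarrow> 'n cvec) \<Rightarrow> ('n cvec \<Rightarrow> complex) \<Rightarrow> 'n rvec \<Rightarrow> complex" where
  "pullback \<gamma> f \<equiv> \<lambda>\<theta>. f (\<gamma> (cis_vec \<theta>))"

lemma cis_vec_in_torus: "cis_vec \<theta> \<in> torus"
  by (simp add: cis_vec_def torus_def)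

lemma torus_eq_image_box: "(torus :: 'a::finite cvec set) = cis_vec ` cbox 0 (\<chi> i. 2 * pi)"
  (is "?T = ?R")
proof
  show "?T \<subseteq> ?R"
  proof
    fix t :: "'a cvec"
    assume "t \<in> torus"
    then have "t = cis_vec (\<chi> i. Arg (t $ i))"
    proof -
      have "t $ i = cis (Arg (t $ i))" for i
      proof -
        have "norm (t $ i) = 1" using \<open>t \<in> torus\<close> by (simp add: torus_def)
        then have "t $ i \<noteq> 0" "sgn (t $ i) = t $ i" by (auto simp: sgn_div_norm)
        then show ?thesis by (simp add: cis_Arg)
      qed
      then show ?thesis by (simp add: cis_vec_def vec_eq_iff)
    qed
    then show "t \<in> ?R"
      by (metis exists_angles_in_box imageI)
  qed
qed (use cis_vec_in_torus in blast)

lemma Cp_angles_pullback: "f \<in> Cp_space \<gamma> p \<Longrightarrow> Cp_angles p (pullback \<gamma> f)"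
  by (simp add: Cp_space_def Cp_torus_iff o_def)

lemma restrict_in_Cp_space:
  assumes "Cp_angles p (pullback \<gamma> f)"
  shows "restrict f (\<gamma> ` torus) \<in> Cp_space \<gamma> p"
  using assms by (simp add: Cp_space_def Cp_torus_iff o_def cis_vec_in_torus)

lemma Cp_seminorm_eq: "Cp_seminorm \<gamma> \<alpha> f = (SUP \<theta>. cmod (multi_deriv \<alpha> (pullback \<gamma> f) \<theta>))"
  by (simp add: Cp_seminorm_def o_def)

lemma norm_multi_deriv_le_seminorm:
  assumes "Cp_angles p (pullback \<gamma> f)" "mi_order \<alpha> \<le> p"
  shows "cmod (multi_deriv \<alpha> (pullback \<gamma> f) \<theta>) \<le> Cp_seminorm \<gamma> \<alpha> f"
  unfolding Cp_seminorm_eq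
  using bounded_multi_deriv[of p "\<lambda>z. f (\<gamma> z)", OF assms] by (rule cSUP_upper2) auto

lemma Cp_seminorm_linear_le:
  assumes F: "Cp_angles p (pullback \<gamma> f)" and G: "Cp_angles p (pullback \<gamma> g)"
    and \<alpha>: "mi_order \<alpha> \<le> p"
  shows "Cp_seminorm \<gamma> \<alpha> (\<lambda>w. f w + c * g w) \<le> Cp_seminorm \<gamma> \<alpha> f + cmod c * Cp_seminorm \<gamma> \<alpha> g"
  unfolding Cp_seminorm_eq[of \<gamma> \<alpha> "\<lambda>w. f w + c * g w"]
proof (rule cSUP_least)
  fix \<theta>
  have "cmod (multi_deriv \<alpha> (pullback \<gamma> f) \<theta> + c * multi_deriv \<alpha> (pullback \<gamma> g) \<theta>) \<le>
        cmod (multi_deriv \<alpha> (pullback \<gamma> f) \<theta>) + cmod c * cmod (multi_deriv \<alpha> (pullback \<gamma> g) \<theta>)"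
    by (metis norm_mult norm_triangle_ineq)
  also have "\<dots> \<le> Cp_seminorm \<gamma> \<alpha> f + cmod c * Cp_seminorm \<gamma> \<alpha> g"
    by (intro add_mono mult_left_mono norm_multi_deriv_le_seminorm[where \<gamma> = \<gamma> and f = f, OF F \<alpha>]
          norm_multi_deriv_le_seminorm[where \<gamma> = \<gamma> and f = g, OF G \<alpha>]) auto
  finally show "cmod (multi_deriv \<alpha> (\<lambda>\<theta>. f (\<gamma> (cis_vec \<theta>)) + c * g (\<gamma> (cis_vec \<theta>))) \<theta>)
       \<le> Cp_seminorm \<gamma> \<alpha> f + cmod c * Cp_seminorm \<gamma> \<alpha> g"
    by (simp add: multi_deriv_linear[OF F G \<alpha>])
qed auto

lemma openin_Cp_seminorm_ball:
  assumes "f \<in> Cp_space \<gamma> p" "mi_order \<alpha> \<le> p" "\<epsilon> > 0"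
  shows "openin (Cp_topology \<gamma> p) {g \<in> Cp_space \<gamma> p. Cp_seminorm \<gamma> \<alpha> (\<lambda>w. g w - f w) < \<epsilon>}"
  unfolding Cp_topology_def using assms by (intro topology_generated_by_Basis) blast

text \<open>
  Joint continuity in the function and the point: the seminorm of order zero is the
  supremum norm, and each single function is continuous.
\<close>
lemma continuous_map_evaluation:
  "continuous_map (prod_topology (Cp_topology \<gamma> p) euclidean) euclidean
     (\<lambda>q. pullback \<gamma> (fst q) (snd q))"
proof -
  have "\<exists>U. openin (prod_topology (Cp_topology \<gamma> p) euclidean) U \<and> (f, \<theta>) \<in> U \<and>
          (\<forall>q\<in>U. dist (pullback \<gamma> f \<theta>) (pullback \<gamma> (fst q) (snd q)) < \<epsilon>)"
    if f: "f \<in> Cp_space \<gamma> p" and \<epsilon>: "\<epsilon> > 0" for f \<theta> \<epsilon>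
  proof -
    have 0: "mi_order (\<lambda>_::'a. 0) \<le> p"
      by (simp add: mi_order_0)
    define A where "A = {g \<in> Cp_space \<gamma> p. Cp_seminorm \<gamma> (\<lambda>_. 0) (\<lambda>w. g w - f w) < \<epsilon> / 2}"
    define V where "V = {\<theta>'. dist (pullback \<gamma> f \<theta>') (pullback \<gamma> f \<theta>) < \<epsilon> / 2}"
    have "continuous_on UNIV (pullback \<gamma> f)"
      using Cp_angles_pullback[OF f] 0 multi_deriv_0 unfolding Cp_angles_def by metis
    then have "open V"
      unfolding V_def by (intro open_Collect_less continuous_intros) auto
    moreover have "openin (Cp_topology \<gamma> p) A"
      unfolding A_def by (rule openin_Cp_seminorm_ball) (use f 0 \<epsilon> in auto)
    ultimately have "openin (prod_topology (Cp_topology \<gamma> p) euclidean) (A \<times> V)"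
      by (simp add: openin_prod_Times_iff)
    moreover have "(f, \<theta>) \<in> A \<times> V"
      using f \<epsilon> by (simp add: A_def V_def Cp_seminorm_eq multi_deriv_zero)
    moreover have "dist (pullback \<gamma> f \<theta>) (pullback \<gamma> (fst q) (snd q)) < \<epsilon>" if "q \<in> A \<times> V" for q
    proof -
      obtain g \<theta>' where q: "q = (g, \<theta>')" "g \<in> A" "\<theta>' \<in> V"
        using \<open>q \<in> A \<times> V\<close> by (cases q) auto
      have g: "g \<in> Cp_space \<gamma> p" using q by (simp add: A_def)
      have "Cp_angles p (pullback \<gamma> (\<lambda>w. g w - f w))"
        using Cp_angles_linear[OF Cp_angles_pullback[OF g] Cp_angles_pullback[OF f], where c = "-1"] by simp
      from norm_multi_deriv_le_seminorm[where \<gamma> = \<gamma> and f = "\<lambda>w. g w - f w", OF this 0, of \<theta>'] q(2)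
      have "dist (pullback \<gamma> g \<theta>') (pullback \<gamma> f \<theta>') < \<epsilon> / 2"
        by (simp add: A_def multi_deriv_0 dist_norm)
      moreover have "dist (pullback \<gamma> f \<theta>') (pullback \<gamma> f \<theta>) < \<epsilon> / 2"
        using q(3) by (simp add: V_def)
      ultimately have "dist (pullback \<gamma> g \<theta>') (pullback \<gamma> f \<theta>) < \<epsilon>"
        using dist_triangle[of "pullback \<gamma> g \<theta>'" "pullback \<gamma> f \<theta>" "pullback \<gamma> f \<theta>'"] by linarith
      then show ?thesis
        by (simp add: q dist_commute)
    qed
    ultimately show ?thesis by blast
  qed
  then have "continuous_map (prod_topology (Cp_topology \<gamma> p) euclidean)
      (Met_TC.mtopology) (\<lambda>q. pullback \<gamma> (fst q) (snd q))"
    unfolding Met_TC.continuous_map_to_metric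
    by (auto simp: topspace_Cp_topology)
  then show ?thesis by simp
qed

text \<open>
  Each seminorm of \<open>f + \<epsilon> g - f'\<close> is a Lipschitz function of \<open>\<epsilon>\<close>, with the seminorm of \<open>g\<close>
  as constant.
\<close>
lemma continuous_map_perturbation:
  assumes f: "f \<in> Cp_space \<gamma> p" and g: "g \<in> Cp_space \<gamma> p"
  shows "continuous_map euclideanreal (Cp_topology \<gamma> p)
           (\<lambda>\<epsilon>. restrict (\<lambda>w. f w + of_real \<epsilon> * g w) (\<gamma> ` torus))"
proof -
  define P where "P = (\<lambda>\<epsilon>::real. restrict (\<lambda>w. f w + of_real \<epsilon> * g w) (\<gamma> ` torus))"
  have F: "Cp_angles p (pullback \<gamma> f)" and G: "Cp_angles p (pullback \<gamma> g)"
    using f g by (auto intro: Cp_angles_pullback)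
  have P: "P \<epsilon> \<in> Cp_space \<gamma> p" for \<epsilon>
    unfolding P_def by (intro restrict_in_Cp_space Cp_angles_linear F G)
  have "open {\<epsilon>. Cp_seminorm \<gamma> \<alpha> (\<lambda>w. P \<epsilon> w - f' w) < \<eta>}"
    if f': "f' \<in> Cp_space \<gamma> p" and \<alpha>: "mi_order \<alpha> \<le> p" for f' \<alpha> \<eta>
  proof -
    define N where "N = (\<lambda>\<epsilon>::real. Cp_seminorm \<gamma> \<alpha> (\<lambda>w. P \<epsilon> w - f' w))"
    let ?S = "Cp_seminorm \<gamma> \<alpha> g"
    have S: "?S \<ge> 0"
      using norm_multi_deriv_le_seminorm[where \<gamma> = \<gamma> and f = g, OF G \<alpha>, of 0] norm_ge_zero order_trans by blast
    have N_le: "N \<epsilon> \<le> N \<delta> + \<bar>\<epsilon> - \<delta>\<bar> * ?S" for \<epsilon> \<delta>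
    proof -
      have "Cp_angles p (pullback \<gamma> (\<lambda>w. P \<delta> w - f' w))"
        using Cp_angles_linear[OF Cp_angles_pullback[OF P] Cp_angles_pullback[OF f'], where c = "-1"] by simp
      from Cp_seminorm_linear_le[where \<gamma> = \<gamma> and f = "\<lambda>w. P \<delta> w - f' w" and g = g, OF this G \<alpha>, of "of_real (\<epsilon> - \<delta>)"]
      have "Cp_seminorm \<gamma> \<alpha> (\<lambda>w. (P \<delta> w - f' w) + of_real (\<epsilon> - \<delta>) * g w) \<le> N \<delta> + \<bar>\<epsilon> - \<delta>\<bar> * ?S"
        by (simp add: N_def del: of_real_diff)
      moreover have "Cp_seminorm \<gamma> \<alpha> (\<lambda>w. (P \<delta> w - f' w) + of_real (\<epsilon> - \<delta>) * g w) = N \<epsilon>"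
        unfolding N_def Cp_seminorm_eq by (simp add: P_def cis_vec_in_torus algebra_simps)
      ultimately show ?thesis by simp
    qed
    have "dist (N \<epsilon>) (N \<delta>) \<le> ?S * dist \<epsilon> \<delta>" for \<epsilon> \<delta>
      using N_le[of \<epsilon> \<delta>] N_le[of \<delta> \<epsilon>]
      by (simp add: dist_real_def abs_le_iff abs_minus_commute mult.commute)
    then have "?S-lipschitz_on UNIV N"
      using S by (intro lipschitz_onI) auto
    then have "continuous_on UNIV N"
      by (rule lipschitz_on_continuous_on)
    then show ?thesis
      using open_Collect_less[of N "\<lambda>_. \<eta>"] by (simp add: N_def)
  qed
  moreover have "P ` UNIV \<subseteq> topspace (Cp_topology \<gamma> p)"
    using P by (auto simp: topspace_Cp_topology)
  ultimately have "continuous_map euclideanreal (Cp_topology \<gamma> p) P"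
    unfolding Cp_topology_def topology_generated_by_topspace
    by (intro continuous_on_generated_topo) (auto simp: P vimage_def)
  then show ?thesis
    by (simp add: P_def)
qed

section \<open>Real analytic functions form an F-sigma set\<close>

text \<open>
  The condition that the series with coefficients \<open>a\<close> represents \<open>f\<close> about \<open>\<theta>\<close> is, for each
  fixed increment \<open>h\<close>, an equation between continuous functions of \<open>(f, \<theta>, a)\<close>. It defines
  a closed set of triples, and \<open>\<theta>\<close> and \<open>a\<close> range over compact sets. Projections along a
  compact factor are closed maps.
\<close>
lemma closedin_has_power_series:
  assumes k: "k > 0" and \<Theta>: "compact \<Theta>"
  shows "closedin (Cp_topology \<gamma> p) {f \<in> Cp_space \<gamma> p. \<exists>\<theta>\<in>\<Theta>. has_power_series k (pullback \<gamma> f) \<theta>}"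
proof -
  let ?X = "Cp_topology \<gamma> p"
  define Y where "Y = prod_topology (top_of_set \<Theta>) (top_of_set (coeff_box k :: (('a \<Rightarrow> nat) \<Rightarrow> complex) set))"
  define H where "H = {h :: 'a rvec. \<forall>i. \<bar>h $ i\<bar> \<le> 1 / (2 * real k)}"
  define Z where "Z = (\<Inter>h\<in>H. {q \<in> topspace (prod_topology ?X Y).
      pullback \<gamma> (fst q) (fst (snd q) + h) = power_series (snd (snd q)) (\<lambda>i. of_real (h $ i))})"
  have "compact_space Y"
    unfolding Y_def using \<Theta> compact_coeff_box
    by (metis compact_space_prod_topology compact_space_subtopology compactin_euclidean_iff)
  then have fst: "closed_map (prod_topology ?X Y) ?X fst"
    by (rule closed_map_fst)
  have H0: "0 \<in> H" by (simp add: H_def)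
  have "closedin (prod_topology ?X Y) Z"
    unfolding Z_def
  proof (rule closedin_INT)
    fix h assume h: "h \<in> H"
    have "continuous_map (top_of_set \<Theta>) euclidean (\<lambda>\<theta>. \<theta> + h)"
      by (auto intro!: continuous_intros)
    then have "continuous_map (prod_topology ?X Y) euclidean (\<lambda>q. fst (snd q) + h)"
      using continuous_map_compose[OF continuous_map_compose[OF continuous_map_snd continuous_map_fst]]
      unfolding Y_def o_def by blast
    then have "continuous_map (prod_topology ?X Y) (prod_topology ?X euclidean)
        (\<lambda>q. (fst q, fst (snd q) + h))"
      by (simp add: continuous_map_paired continuous_map_fst)
    from continuous_map_compose[OF this continuous_map_evaluation]
    have 1: "continuous_map (prod_topology ?X Y) euclidean (\<lambda>q. pullback \<gamma> (fst q) (fst (snd q) + h))"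
      by (simp add: o_def)
    have "continuous_map (top_of_set (coeff_box k)) euclidean
             (\<lambda>a. power_series a (\<lambda>i. of_real (h $ i)))"
      using continuous_on_power_series_coeffs[OF k, of "\<lambda>i. of_real (h $ i)"] h by (simp add: H_def)
    then have 2: "continuous_map (prod_topology ?X Y) euclidean
             (\<lambda>q. power_series (snd (snd q)) (\<lambda>i. of_real (h $ i)))"
      using continuous_map_compose[OF continuous_map_compose[OF continuous_map_snd continuous_map_snd]]
      unfolding Y_def o_def by blast
    show "closedin (prod_topology ?X Y) {q \<in> topspace (prod_topology ?X Y).
      pullback \<gamma> (fst q) (fst (snd q) + h) = power_series (snd (snd q)) (\<lambda>i. of_real (h $ i))}"
      using closedin_continuous_maps_eq[OF Hausdorff_space_euclidean 1 2] .
  qed (use H0 in blast)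
  then have "closedin ?X (fst ` Z)"
    using fst by (simp add: closed_map_def)
  also have "fst ` Z = {f \<in> Cp_space \<gamma> p. \<exists>\<theta>\<in>\<Theta>. has_power_series k (pullback \<gamma> f) \<theta>}"
  proof (intro equalityI subsetI)
    fix f assume "f \<in> fst ` Z"
    then obtain \<theta> a where Z: "(f, \<theta>, a) \<in> Z"
      by auto
    have *: "(f, \<theta>, a) \<in> topspace (prod_topology ?X Y)"
      and eq: "\<And>h. h \<in> H \<Longrightarrow> pullback \<gamma> f (\<theta> + h) = power_series a (\<lambda>i. of_real (h $ i))"
      using Z H0 unfolding Z_def by auto
    have "f \<in> Cp_space \<gamma> p" "\<theta> \<in> \<Theta>" "a \<in> coeff_box k"
      using * by (auto simp: Y_def topspace_Cp_topology)
    then show "f \<in> {f \<in> Cp_space \<gamma> p. \<exists>\<theta>\<in>\<Theta>. has_power_series k (pullback \<gamma> f) \<theta>}"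
      using eq unfolding has_power_series_def H_def by blast
  next
    fix f assume "f \<in> {f \<in> Cp_space \<gamma> p. \<exists>\<theta>\<in>\<Theta>. has_power_series k (pullback \<gamma> f) \<theta>}"
    then obtain \<theta> a where "f \<in> Cp_space \<gamma> p" "\<theta> \<in> \<Theta>" "a \<in> coeff_box k"
      "\<And>h. h \<in> H \<Longrightarrow> pullback \<gamma> f (\<theta> + h) = power_series a (\<lambda>i. of_real (h $ i))"
      unfolding has_power_series_def H_def by blast
    then have "(f, \<theta>, a) \<in> Z"
      by (auto simp: Z_def Y_def topspace_Cp_topology)
    then show "f \<in> fst ` Z"
      by force
  qed
  finally show ?thesis .
qed

lemma gdelta_in_no_power_series:
  assumes "compact \<Theta>"
  shows "gdelta_in (Cp_topology \<gamma> p)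
           {f \<in> Cp_space \<gamma> p. \<forall>\<theta>\<in>\<Theta>. \<not> (\<exists>k>0. has_power_series k (pullback \<gamma> f) \<theta>)}"
proof -
  define A where "A k f \<longleftrightarrow> (\<exists>\<theta>\<in>\<Theta>. has_power_series k (pullback \<gamma> f) \<theta>)" for k f
  have "closedin (Cp_topology \<gamma> p) {f \<in> Cp_space \<gamma> p. A k f}" if "k > 0" for k
    unfolding A_def by (rule closedin_has_power_series[OF that assms])
  then have "fsigma_in (Cp_topology \<gamma> p) (\<Union>k\<in>{0<..}. {f \<in> Cp_space \<gamma> p. A k f})"
    by (intro fsigma_in_Union) (auto intro: closed_imp_fsigma_in)
  then have "gdelta_in (Cp_topology \<gamma> p)
      (topspace (Cp_topology \<gamma> p) - (\<Union>k\<in>{0<..}. {f \<in> Cp_space \<gamma> p. A k f}))"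
    by (intro gdelta_in_diff gdelta_in_topspace)
  also have "topspace (Cp_topology \<gamma> p) - (\<Union>k\<in>{0<..}. {f \<in> Cp_space \<gamma> p. A k f}) =
      {f \<in> Cp_space \<gamma> p. \<not> (\<exists>k>0. A k f)}"
    unfolding topspace_Cp_topology
    by (simp only: set_eq_iff Diff_iff UN_iff mem_Collect_eq greaterThan_iff) blast
  also have "\<dots> = {f \<in> Cp_space \<gamma> p. \<forall>\<theta>\<in>\<Theta>. \<not> (\<exists>k>0. has_power_series k (pullback \<gamma> f) \<theta>)}"
  proof -
    have "\<not> (\<exists>k>0. A k f) \<longleftrightarrow> (\<forall>\<theta>\<in>\<Theta>. \<not> (\<exists>k>0. has_power_series k (pullback \<gamma> f) \<theta>))" for f
      unfolding A_def by metis
    then show ?thesis by (simp only:)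
  qed
  finally show ?thesis .
qed

section \<open>Density of the nowhere real analytic functions\<close>

text \<open>
  Given \<open>f\<close> in an open set \<open>T\<close>, let \<open>g\<close> be the lacunary series in one angle; \<open>\<gamma>\<close> being
  injective, \<open>g\<close> is a well-defined function on the image of the torus. The set of all \<open>\<epsilon>\<close>
  with \<open>f + \<epsilon> g\<close> in \<open>T\<close> is uncountable. If all these functions were analytic somewhere,
  each of them would be holomorphic along the coordinate \<open>j\<close> at some point of a countable
  dense set. Two of them would share such a point \<open>q\<close>, and their difference would make \<open>g\<close>
  itself holomorphic along \<open>j\<close> at \<open>q\<close>.
\<close>
lemma dense_no_power_series:
  fixes \<gamma> :: "'n::{finite,linorder} cvec \<Rightarrow> 'n cvec"
  assumes inj: "inj_on \<gamma> torus"
  shows "Cp_topology \<gamma> p closure_of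
           {f \<in> Cp_space \<gamma> p. \<forall>\<theta>. \<not> (\<exists>k>0. has_power_series k (pullback \<gamma> f) \<theta>)} = Cp_space \<gamma> p"
    (is "_ closure_of ?S = _")
proof -
  \<comment> \<open>Any coordinate will do; a type is never empty.\<close>
  fix j :: 'n
  define g where "g = restrict (\<lambda>w. lacunary 0 ((SOME \<theta>. \<gamma> (cis_vec \<theta>) = w) $ j)) (\<gamma> ` torus)"
  have g: "pullback \<gamma> g = (\<lambda>\<theta>. lacunary 0 (\<theta> $ j))"
  proof
    fix \<theta>
    \<comment> \<open>The chosen angles need not be the given ones, but \<open>\<gamma>\<close> is injective and the series is periodic.\<close>
    define \<theta>' where "\<theta>' = (SOME \<theta>'. \<gamma> (cis_vec \<theta>') = \<gamma> (cis_vec \<theta>))"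
    have "\<gamma> (cis_vec \<theta>') = \<gamma> (cis_vec \<theta>)"
      unfolding \<theta>'_def by (rule someI) (rule refl)
    then have "cis_vec \<theta>' = cis_vec \<theta>"
      using inj_onD[OF inj] cis_vec_in_torus by blast
    then have "cis (\<theta>' $ j) = cis (\<theta> $ j)"
      by (simp add: cis_vec_def vec_eq_iff)
    then show "pullback \<gamma> g \<theta> = lacunary 0 (\<theta> $ j)"
      using lacunary_cis_cong[of "\<theta>' $ j" "\<theta> $ j"] by (simp add: g_def cis_vec_in_torus \<theta>'_def)
  qed
  have "Cp_angles p (pullback \<gamma> g)"
    unfolding g by (rule Cp_angles_lacunary)
  then have g_Cp: "g \<in> Cp_space \<gamma> p"
    by (simp add: Cp_space_def Cp_torus_iff o_def) (simp add: g_def)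
  obtain Q :: "'n rvec set" where Q: "countable Q" "\<And>V. open V \<Longrightarrow> V \<noteq> {} \<Longrightarrow> \<exists>q\<in>Q. q \<in> V"
    using countable_dense_exists by metis
  have "?S \<inter> T \<noteq> {}" if T: "openin (Cp_topology \<gamma> p) T" "T \<noteq> {}" for T
  proof
    assume empty: "?S \<inter> T = {}"
    obtain f where "f \<in> T" using T by auto
    then have f: "f \<in> Cp_space \<gamma> p"
      using openin_subset[OF T(1)] by (auto simp: topspace_Cp_topology)
    define P where "P = (\<lambda>\<epsilon>::real. restrict (\<lambda>w. f w + of_real \<epsilon> * g w) (\<gamma> ` torus))"
    have cont: "continuous_map euclideanreal (Cp_topology \<gamma> p) P"
      unfolding P_def by (rule continuous_map_perturbation[OF f g_Cp])
    define E where "E = {\<epsilon>. P \<epsilon> \<in> T}"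
    have "open E"
      using openin_continuous_map_preimage[OF cont T(1)] by (simp add: E_def)
    moreover have "P 0 = f"
      using f by (auto simp: P_def Cp_space_def extensional_def)
    then have "0 \<in> E" using \<open>f \<in> T\<close> by (simp add: E_def)
    ultimately obtain d where "d > 0" "ball 0 d \<subseteq> E"
      by (meson open_contains_ball)
    then have "uncountable E"
      using uncountable_ball[of d 0] countable_subset by blast
    have "\<exists>q\<in>Q. holomorphic_along j (pullback \<gamma> (P \<epsilon>)) q" if "\<epsilon> \<in> E" for \<epsilon>
    proof -
      have PT: "P \<epsilon> \<in> T"
        using that by (simp add: E_def)
      then have "P \<epsilon> \<notin> ?S"
        using empty by blast
      moreover have "P \<epsilon> \<in> Cp_space \<gamma> p"
        using PT openin_subset[OF T(1)] by (auto simp: topspace_Cp_topology)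
      ultimately obtain \<theta> k where k: "k > 0" and ps: "has_power_series k (pullback \<gamma> (P \<epsilon>)) \<theta>"
        unfolding mem_Collect_eq by metis
      obtain q where q: "q \<in> Q" "q \<in> ball \<theta> (1 / (4 * real k))"
        using Q(2)[of "ball \<theta> (1 / (4 * real k))"] k by auto
      have "\<bar>q $ i - \<theta> $ i\<bar> \<le> 1 / (4 * real k)" for i
        using component_le_norm_cart[of "q - \<theta>" i] q(2) by (simp add: dist_norm norm_minus_commute)
      then show ?thesis
        using has_power_series_imp_holomorphic_along[OF k ps] q(1) by blast
    qed
    then obtain q where q: "\<And>\<epsilon>. \<epsilon> \<in> E \<Longrightarrow> q \<epsilon> \<in> Q"
        "\<And>\<epsilon>. \<epsilon> \<in> E \<Longrightarrow> holomorphic_along j (pullback \<gamma> (P \<epsilon>)) (q \<epsilon>)"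
      by metis
    have "inj_on q E"
    proof (rule inj_onI, rule ccontr)
      fix \<epsilon> \<delta> assume E: "\<epsilon> \<in> E" "\<delta> \<in> E" and eq: "q \<epsilon> = q \<delta>" and ne: "\<epsilon> \<noteq> \<delta>"
      have "holomorphic_along j (\<lambda>\<theta>. 1 / of_real (\<epsilon> - \<delta>) *
               (pullback \<gamma> (P \<epsilon>) \<theta> - pullback \<gamma> (P \<delta>) \<theta>)) (q \<epsilon>)"
        using q(2)[OF E(1)] q(2)[OF E(2)] eq by (intro holomorphic_along_scaled_diff) auto
      also have "(\<lambda>\<theta>. 1 / of_real (\<epsilon> - \<delta>) * (pullback \<gamma> (P \<epsilon>) \<theta> - pullback \<gamma> (P \<delta>) \<theta>)) =
                   pullback \<gamma> g"
        using ne by (auto simp: P_def cis_vec_in_torus field_simps)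
      finally show False
        using not_holomorphic_along_lacunary by (auto simp: g)
    qed
    then have "countable E"
      using Q(1) q(1) by (meson countable_image_inj_on countable_subset image_subsetI)
    with \<open>uncountable E\<close> show False by contradiction
  qed
  then show ?thesis
    using dense_intersects_open[of "Cp_topology \<gamma> p" ?S] by (simp add: topspace_Cp_topology)
qed

section \<open>The two dense G-delta sets\<close>

lemma curve_real_analytic_at_iff:
  assumes "inj_on \<gamma> torus"
  shows "curve_real_analytic_at \<gamma> f (\<gamma> (cis_vec \<theta>)) \<longleftrightarrow>
           (\<exists>k>0. has_power_series k (pullback \<gamma> f) \<theta>)"
proof -
  have "curve_real_analytic_at \<gamma> f (\<gamma> (cis_vec \<theta>)) \<longleftrightarrow> torus_real_analytic_at (f \<circ> \<gamma>) (cis_vec \<theta>)"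
    unfolding curve_real_analytic_at_def using inj_onD[OF assms] cis_vec_in_torus by metis
  then show ?thesis
    by (simp add: torus_real_analytic_at_iff o_def)
qed

lemma inj_on_prod_curve:
  assumes "\<And>i. extended_Riemann_map (\<Omega> i) (\<phi> i)"
  shows "inj_on (prod_curve \<phi>) torus"
proof (rule inj_onI)
  fix s t assume st: "s \<in> torus" "t \<in> torus" and eq: "prod_curve \<phi> s = prod_curve \<phi> t"
  have "s $ i = t $ i" for i
  proof -
    obtain \<psi> where "homeomorphism (cball 0 1) (closure (\<Omega> i)) (\<phi> i) \<psi>"
      using assms[of i] by (auto simp: extended_Riemann_map_def)
    then have "inj_on (\<phi> i) (cball 0 1)"
      by (metis homeomorphism_def inj_on_inverseI)
    moreover have "\<phi> i (s $ i) = \<phi> i (t $ i)"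
      using eq by (simp add: prod_curve_def vec_eq_iff)
    ultimately show ?thesis
      using st by (auto simp: torus_def dest: inj_onD)
  qed
  then show "s = t" by (simp add: vec_eq_iff)
qed

theorem theorem16:
  fixes \<Omega> :: "'n::{finite,linorder} \<Rightarrow> complex set"
    and \<phi> :: "'n \<Rightarrow> complex \<Rightarrow> complex"
    and \<gamma> :: "'n cvec \<Rightarrow> 'n cvec"
    and p :: enat
  assumes "\<And>i. Jordan_domain (\<Omega> i)"
    and "\<And>i. extended_Riemann_map (\<Omega> i) (\<phi> i)"
    and "\<gamma> = prod_curve \<phi>"
    and "\<And>i. analytic_boundary_curve (\<Omega> i) (\<phi> i)"
  shows "(\<forall>w\<in>\<gamma> ` torus.
            dense_gdelta_in (Cp_topology \<gamma> p)
              {f \<in> Cp_space \<gamma> p. \<not> curve_real_analytic_at \<gamma> f w}) \<and>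
         dense_gdelta_in (Cp_topology \<gamma> p)
           {f \<in> Cp_space \<gamma> p. \<forall>w\<in>\<gamma> ` torus. \<not> curve_real_analytic_at \<gamma> f w}"
proof -
  have inj: "inj_on \<gamma> torus"
    unfolding assms(3) by (rule inj_on_prod_curve) (rule assms(2))
  \<comment> \<open>The whole torus is the image of one period; for a fixed point a single choice of angles suffices.\<close>
  let ?N = "\<lambda>\<Theta>. {f \<in> Cp_space \<gamma> p. \<forall>\<theta>\<in>\<Theta>. \<not> (\<exists>k>0. has_power_series k (pullback \<gamma> f) \<theta>)}"
  have generic: "dense_gdelta_in (Cp_topology \<gamma> p) (?N \<Theta>)" if "compact \<Theta>" for \<Theta>
  proof -
    have "Cp_topology \<gamma> p closure_of ?N UNIV \<subseteq> Cp_topology \<gamma> p closure_of ?N \<Theta>"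
      by (intro closure_of_mono) blast
    then have "Cp_topology \<gamma> p closure_of ?N \<Theta> = topspace (Cp_topology \<gamma> p)"
      using dense_no_power_series[OF inj, of p] closure_of_subset_topspace[of "Cp_topology \<gamma> p" "?N \<Theta>"]
      by (simp add: topspace_Cp_topology subset_antisym)
    then show ?thesis
      unfolding dense_gdelta_in_def using gdelta_in_no_power_series[OF that] by blast
  qed
  show ?thesis
  proof (intro conjI ballI)
    fix w assume "w \<in> \<gamma> ` torus"
    then obtain \<theta> where w: "w = \<gamma> (cis_vec \<theta>)"
      by (auto simp: torus_eq_image_box)
    show "dense_gdelta_in (Cp_topology \<gamma> p) {f \<in> Cp_space \<gamma> p. \<not> curve_real_analytic_at \<gamma> f w}"
      using generic[of "{\<theta>}"] by (simp add: w curve_real_analytic_at_iff[OF inj])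
  next
    show "dense_gdelta_in (Cp_topology \<gamma> p)
           {f \<in> Cp_space \<gamma> p. \<forall>w\<in>\<gamma> ` torus. \<not> curve_real_analytic_at \<gamma> f w}"
      using generic[of "cbox 0 (\<chi> i. 2 * pi)"]
      by (simp add: torus_eq_image_box curve_real_analytic_at_iff[OF inj])
  qed
qed

end
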